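(* Let $\mathcal{A}$ be a unital complex algebra, $\psi:\mathcal{A}\to\mathbb{C}$ a unital linear functional, $D\psi:\mathcal{A}\to\mathbb{C}$ a tracial linear functional with $D\psi(1_{\mathcal{A}})=0$, with free cumulants $\kappa^\psi$ and cyclic free cumulants $D\kappa^\psi$. Let $p\ge1$, $a_1,\ldots,a_p\in\mathcal{A}$, $n\ge2$, and let $I=\{I_1,\ldots,I_n\}$ be a partition of $\{1,\ldots,p\}$ into $n$ intervals, listed from left to right; put $a_{I_k}=\prod_{i\in I_k}a_i\in\mathcal{A}$ (product in increasing order of indices). Then for every $\pi\in NCZ(n)$, $$[\kappa^\psi,D\kappa^\psi]^{(B)}_\pi(a_{I_1},\ldots,a_{I_n})=\sum_{\substack{\sigma\in NCZ(p)\\ \sigma\vee\bar I=\hat\pi}}[\kappa^\psi,D\kappa^\psi]^{(B)}_\sigma(a_1,\ldots,a_p).$$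
   Context: Free cumulants $\kappa^\psi_n$: $\psi(a_1\cdots a_n)=\sum_{\pi\in NC(n)}\prod_{V\in\pi}\kappa^\psi_{|V|}(a_V)$, with $NC(n)$ the non-crossing partitions of $\{1,\ldots,n\}$ and $a_V$ listing $(a_v)_{v\in V}$ in increasing order. Cyclic free cumulants $D\kappa^\psi_n$ (they are cyclically invariant), recursively: $D\psi(a_1\cdots a_n)=\sum_{\pi\in NC(n)}\sum_{V\in\pi}D\kappa^\psi_{|V|}(a_V)\prod_{W\in\pi,W\neq V}\kappa^\psi_{|W|}(a_{(W,\prec_V)})$. Here and below, for a subset $O\subset\{1,\ldots,n\}$, arrange $1,\ldots,n$ clockwise on a circle; a block $W$ disjoint from and not crossing $O$ lies in one arc between two cyclically consecutive elements of $O$ (the whole circle minus $O$ if $|O|=1$), and $a_{(W,\prec_O)}$ lists $(a_w)_{w\in W}$ in the order met when traversing this arc clockwise. Type B partitions: $NC^{(B)}(n)$ is the lattice (for refinement) of partitions of $\{1,\ldots,n,-1,\ldots,-n\}$ that are non-crossing for the circular order $1,\ldots,n,-1,\ldots,-n$ and invariant under $x\mapsto-x$. A zero block is a block $Z=-Z$ (there is at most one). $NCZ(n)$ is the set of $\pi\in NC^{(B)}(n)$ having a zero block. $\mathrm{Abs}(\pi)\in NC(n)$ is the image of $\pi$ under absolute value. For $\pi\in NCZ(n)$ let $O\in\mathrm{Abs}(\pi)$ be the image of its zero block; then $$[f,g]^{(B)}_\pi(a_1,\ldots,a_n)=g_{|O|}(a_O)\prod_{V\in\mathrm{Abs}(\pi),V\ne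 O}f_{|V|}(a_{(V,\prec_O)}).$$ $\bar I=\{I_1,-I_1,\ldots,I_n,-I_n\}\in NC^{(B)}(p)$. Setting $I_{-k}=-I_k$, $\hat\pi$ is the partition of $\{\pm1,\ldots,\pm p\}$ in which $i\sim_{\hat\pi}j$ iff $i\in I_k$, $j\in I_l$ with $k\sim_\pi l$ ($k,l\in\{\pm1,\ldots,\pm n\}$); it belongs to $NCZ(p)$. The join $\vee$ is taken in $NC^{(B)}(p)$. *)

theory Defs
  imports Complex_Main "HOL-Library.Disjoint_Sets" "HOL-Algebra.Lattice"
begin

section \<open>Algebras and linear functionals\<close>

locale unital_complex_algebra = vector_space scale
  for scale :: "complex \<Rightarrow> 'a::ring_1 \<Rightarrow> 'a" +
  assumes scale_mult_left: "scale c x * y = scale c (x * y)"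
    and scale_mult_right: "x * scale c y = scale c (x * y)"

abbreviation linear_functional :: "(complex \<Rightarrow> 'a::ring_1 \<Rightarrow> 'a) \<Rightarrow> ('a \<Rightarrow> complex) \<Rightarrow> bool" where
  "linear_functional scale \<phi> \<equiv> Vector_Spaces.linear scale (*) \<phi>"

definition tracial :: "('a::ring_1 \<Rightarrow> complex) \<Rightarrow> bool" where
  "tracial \<phi> \<longleftrightarrow> (\<forall>x y. \<phi> (x * y) = \<phi> (y * x))"


section \<open>Non-crossing partitions\<close>

text \<open>The function \<open>pos\<close> gives the positions of the points in the (linear or circular) order;
  cutting a circular order at any point does not change which blocks cross.\<close>

definition noncrossing :: "('b \<Rightarrow> nat) \<Rightarrow> 'b set set \<Rightarrow> bool" where
  "noncrossing pos P \<longleftrightarrow>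
     (\<forall>V\<in>P. \<forall>W\<in>P. V \<noteq> W \<longrightarrow>
        \<not> (\<exists>a\<in>V. \<exists>b\<in>W. \<exists>c\<in>V. \<exists>d\<in>W. pos a < pos b \<and> pos b < pos c \<and> pos c < pos d))"

definition NC :: "nat \<Rightarrow> nat set set set" where
  "NC n = {P. partition_on {1..n} P \<and> noncrossing (\<lambda>i. i) P}"

definition subword :: "(nat \<Rightarrow> 'a) \<Rightarrow> nat set \<Rightarrow> 'a list" where
  "subword a V = map a (sorted_list_of_set V)"

text \<open>The elements strictly between \<open>v\<close> and the next element of \<open>U\<close> in clockwise direction,
  in clockwise order, on the circle \<open>1, \<dots>, n\<close>.\<close>

definition arc :: "nat \<Rightarrow> nat set \<Rightarrow> nat \<Rightarrow> nat list" where
  "arc n U v = takeWhile (\<lambda>i. i \<notin> U) ([Suc v..<Suc n] @ [1..<v])"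

definition cyclic_subword :: "nat \<Rightarrow> (nat \<Rightarrow> 'a) \<Rightarrow> nat set \<Rightarrow> nat set \<Rightarrow> 'a list" where
  "cyclic_subword n a U W =
     map a (filter (\<lambda>i. i \<in> W) (arc n U (THE v. v \<in> U \<and> W \<subseteq> set (arc n U v))))"


section \<open>Free cumulants and cyclic free cumulants\<close>

text \<open>A family of functionals of all arities is a function on lists. The letters of a list
  \<open>xs\<close> are numbered from 1, as in \<^term>\<open>letter xs\<close>. The moment-cumulant formulas are solved for
  the summand belonging to the partition with a single block; they are recovered in
  \<open>moment_free_cumulant\<close> and \<open>moment_cyclic_free_cumulant\<close> below. Lists are meant to be non-empty; the value 0
  on the empty list is a convention and is never used, since blocks are non-empty.\<close>

definition letter :: "'a list \<Rightarrow> nat \<Rightarrow> 'a" where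
  "letter xs i = xs ! (i - 1)"

lemma length_subword: "finite V \<Longrightarrow> length (subword a V) = card V"
  by (simp add: subword_def)

lemma NC_block_finite:
  assumes "P \<in> NC n" "V \<in> P" shows "finite V"
proof -
  have "V \<subseteq> {1..n}"
    using assms by (auto simp: NC_def partition_on_def)
  then show ?thesis by (rule finite_subset) simp
qed

lemma NC_block_card_less:
  assumes "P \<in> NC n - {{{1..n}}}" "V \<in> P"
  shows "card V < n"
proof -
  have part: "partition_on {1..n} P" and ne: "P \<noteq> {{1..n}}"
    using assms(1) by (auto simp: NC_def)
  have sub: "V \<subseteq> {1..n}"
    using part assms(2) by (auto simp: partition_on_def)
  have "V \<noteq> {1..n}"
  proof
    assume V: "V = {1..n}"
    have "W = V" if "W \<in> P" for W
    proof (rule ccontr)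
      assume "W \<noteq> V"
      then have "W \<inter> V = {}"
        using part that assms(2) by (auto simp: partition_on_def disjoint_def)
      moreover have "W \<subseteq> {1..n}" "W \<noteq> {}"
        using part that by (auto simp: partition_on_def)
      ultimately show False using V by blast
    qed
    then show False using ne V assms(2) by blast
  qed
  then have "card V < card {1..n}"
    using sub by (intro psubset_card_mono) auto
  then show ?thesis by simp
qed

lemma length_subword_less:
  assumes "P \<in> NC n - {{{1..n}}}" "V \<in> P"
  shows "length (subword a V) < n"
  using NC_block_card_less[OF assms] NC_block_finite[of P n V] assms
  by (simp add: length_subword)

function free_cumulant :: "('a::ring_1 \<Rightarrow> complex) \<Rightarrow> 'a list \<Rightarrow> complex" where
  "free_cumulant \<psi> xs = (if xs = [] then 0 else
     \<psi> (prod_list xs) -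
     (\<Sum>P\<in>NC (length xs) - {{{1..length xs}}}.
        \<Prod>V\<in>P. free_cumulant \<psi> (subword (letter xs) V)))"
  by pat_completeness auto
termination
proof (relation "measure (\<lambda>(\<psi>, xs). length xs)", goal_cases)
  case 1 show ?case by (rule wf_measure)
next
  case (2 \<psi> xs P V)
  then show ?case by (simp add: length_subword_less del: Diff_iff)
qed

function cyclic_free_cumulant ::
  "('a::ring_1 \<Rightarrow> complex) \<Rightarrow> ('a \<Rightarrow> complex) \<Rightarrow> 'a list \<Rightarrow> complex" where
  "cyclic_free_cumulant \<psi> \<delta> xs = (if xs = [] then 0 else
     \<delta> (prod_list xs) -
     (\<Sum>P\<in>NC (length xs) - {{{1..length xs}}}.
        \<Sum>V\<in>P. cyclic_free_cumulant \<psi> \<delta> (subword (letter xs) V) *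
          (\<Prod>W\<in>P - {V}. free_cumulant \<psi> (cyclic_subword (length xs) (letter xs) V W))))"
  by pat_completeness auto
termination
proof (relation "measure (\<lambda>(\<psi>, \<delta>, xs). length xs)", goal_cases)
  case 1 show ?case by (rule wf_measure)
next
  case (2 \<psi> \<delta> xs P V)
  then show ?case by (simp add: length_subword_less del: Diff_iff)
qed

declare free_cumulant.simps [simp del] cyclic_free_cumulant.simps [simp del]

lemma finite_NC: "finite (NC n)"
  by (rule finite_subset[of _ "Pow (Pow {1..n})"]) (auto simp: NC_def partition_on_def)

lemma single_block_in_NC: "n > 0 \<Longrightarrow> {{1..n}} \<in> NC n"
  by (auto simp: NC_def noncrossing_def partition_on_def)

lemma subword_letter_full: "subword (letter xs) {1..length xs} = xs"
proof -
  have "sorted_list_of_set {1..length xs} = [1..<Suc (length xs)]"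
    by (metis atLeastLessThanSuc_atLeastAtMost sorted_list_of_set_range)
  then show ?thesis
    by (intro nth_equalityI) (auto simp: subword_def letter_def simp del: upt_Suc)
qed

lemma moment_free_cumulant:
  assumes "xs \<noteq> []"
  shows "\<psi> (prod_list xs) =
    (\<Sum>P\<in>NC (length xs). \<Prod>V\<in>P. free_cumulant \<psi> (subword (letter xs) V))"
proof -
  have "{{1..length xs}} \<in> NC (length xs)"
    using assms by (intro single_block_in_NC) simp
  from sum.remove[OF finite_NC this, of "\<lambda>P. \<Prod>V\<in>P. free_cumulant \<psi> (subword (letter xs) V)"]
  show ?thesis
    using free_cumulant.simps[of \<psi> xs] subword_letter_full[of xs] assms by simp
qed

lemma moment_cyclic_free_cumulant:
  assumes "xs \<noteq> []"
  shows "\<delta> (prod_list xs) =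
    (\<Sum>P\<in>NC (length xs). \<Sum>V\<in>P. cyclic_free_cumulant \<psi> \<delta> (subword (letter xs) V) *
       (\<Prod>W\<in>P - {V}. free_cumulant \<psi> (cyclic_subword (length xs) (letter xs) V W)))"
proof -
  have "{{1..length xs}} \<in> NC (length xs)"
    using assms by (intro single_block_in_NC) simp
  from sum.remove[OF finite_NC this, of "\<lambda>P. \<Sum>V\<in>P. cyclic_free_cumulant \<psi> \<delta> (subword (letter xs) V) *
       (\<Prod>W\<in>P - {V}. free_cumulant \<psi> (cyclic_subword (length xs) (letter xs) V W))"]
  show ?thesis
    using cyclic_free_cumulant.simps[of \<psi> \<delta> xs] subword_letter_full[of xs] assms by simp
qed


section \<open>Non-crossing partitions of type B\<close>

definition signed_points :: "nat \<Rightarrow> int set" where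
  "signed_points n = {i. i \<noteq> 0 \<and> \<bar>i\<bar> \<le> int n}"

text \<open>Position in the circular order \<open>1, \<dots>, n, -1, \<dots>, -n\<close>.\<close>

definition signed_pos :: "nat \<Rightarrow> int \<Rightarrow> nat" where
  "signed_pos n i = (if i > 0 then nat i else n + nat (- i))"

definition NCB :: "nat \<Rightarrow> int set set set" where
  "NCB n = {P. partition_on (signed_points n) P \<and> noncrossing (signed_pos n) P \<and>
               (`) uminus ` P = P}"

definition NCB_order :: "nat \<Rightarrow> int set set gorder" where
  "NCB_order n = \<lparr>carrier = NCB n, eq = (=), le = refines (signed_points n)\<rparr>"

definition zero_block :: "int set \<Rightarrow> bool" where
  "zero_block Z \<longleftrightarrow> uminus ` Z = Z"

definition NCZ :: "nat \<Rightarrow> int set set set" where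
  "NCZ n = {P \<in> NCB n. \<exists>Z\<in>P. zero_block Z}"

definition abs_block :: "int set \<Rightarrow> nat set" where
  "abs_block V = (\<lambda>i. nat \<bar>i\<bar>) ` V"

definition abs_partition :: "int set set \<Rightarrow> nat set set" where
  "abs_partition P = abs_block ` P"

definition zero_image :: "int set set \<Rightarrow> nat set" where
  "zero_image P = abs_block (THE Z. Z \<in> P \<and> zero_block Z)"

definition bracketB ::
  "nat \<Rightarrow> ('a list \<Rightarrow> complex) \<Rightarrow> ('a list \<Rightarrow> complex) \<Rightarrow> int set set \<Rightarrow> (nat \<Rightarrow> 'a) \<Rightarrow> complex"
where
  "bracketB n f g \<pi> a =
     g (subword a (zero_image \<pi>)) *
     (\<Prod>V\<in>abs_partition \<pi> - {zero_image \<pi>}. f (cyclic_subword n a (zero_image \<pi>) V))"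


section \<open>Interval partitions\<close>

definition ordered_interval_partition :: "nat \<Rightarrow> nat \<Rightarrow> (nat \<Rightarrow> nat set) \<Rightarrow> bool" where
  "ordered_interval_partition p n I \<longleftrightarrow>
     partition_on {1..p} (I ` {1..n}) \<and>
     (\<forall>k\<in>{1..n}. \<exists>l r. I k = {l..r}) \<and>
     (\<forall>k\<in>{1..n}. \<forall>l\<in>{1..n}. k < l \<longrightarrow> (\<forall>i\<in>I k. \<forall>j\<in>I l. i < j))"

definition signed_interval :: "(nat \<Rightarrow> nat set) \<Rightarrow> int \<Rightarrow> int set" where
  "signed_interval I k = (if k > 0 then int ` I (nat k) else uminus ` int ` I (nat (- k)))"

definition barI :: "nat \<Rightarrow> (nat \<Rightarrow> nat set) \<Rightarrow> int set set" where
  "barI n I = signed_interval I ` signed_points n"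

definition hat_partition ::
  "nat \<Rightarrow> nat \<Rightarrow> (nat \<Rightarrow> nat set) \<Rightarrow> int set set \<Rightarrow> int set set" where
  "hat_partition p n I \<pi> =
     signed_points p //
       {(i, j). \<exists>k\<in>signed_points n. \<exists>l\<in>signed_points n.
          i \<in> signed_interval I k \<and> j \<in> signed_interval I l \<and> (\<exists>V\<in>\<pi>. k \<in> V \<and> l \<in> V)}"

end

theory Submission
  imports Defs
begin

text \<open>Both sides are determined by their sums over the refinements of \<open>\<pi>\<close> in \<open>NCZ n\<close>, by induction
  along the refinement order, so it suffices to compare these sums. On the left the sum is the
  bracket of the moment functionals \<open>[\<psi>, D\<psi>]\<close> at \<open>\<pi>\<close> by the moment-cumulant formulas. On the right,
  sorting the refinements \<open>\<sigma>\<close> of the hat of \<open>\<pi>\<close> according to their join with the interval partition (which is the hat of a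
  unique \<open>\<rho>\<close>) turns the sum into the same bracket at the hat of \<open>\<pi>\<close>, and the two brackets of moments agree
  because they multiply the same letters in the same order.

  A partition in \<open>NCZ n\<close> is the same thing as a pair of a non-crossing partition of \<open>{1..n}\<close> and one of
  its blocks \<open>U\<close>, the image of the zero block. Cutting the circle at an arbitrary point of \<open>U\<close> makes
  all other blocks, with their cyclic order relative to \<open>U\<close>, into linearly ordered blocks.\<close>

section \<open>Cutting the circle\<close>

text \<open>The detour through moments has one reason: the value of a moment functional on a word
  depends only on the product of its letters, so grouping letters into intervals is invisible to it,
  whereas a cumulant sees the individual letters. Neither a Moebius function nor a complement map
  has to be computed. The type B structure enters only through its order. The hat is an order
  isomorphism from \<open>NCB n\<close> onto the part of \<open>NCB p\<close> above
  \<open>barI n I\<close>, and the map \<open>\<sigma> \<mapsto> \<rho>\<close> given by the join is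
  its lower adjoint. The obstacle is that the order in which a block is read depends on the root,
  and the root shrinks when a partition is refined. Two things help. A block outside the old root is
  read in the same order from every point of the old root, hence also from the smaller new one. For
  blocks inside the old root, the cyclic moment-cumulant formula already prescribes the order
  relative to the new root. Signs cause a similar difficulty: the two copies of a non-root block can
  be told apart only after a point of the root has been fixed.\<close>

lemma noncrossingD:
  assumes "noncrossing pos P" "V \<in> P" "W \<in> P" "V \<noteq> W" "a \<in> V" "b \<in> W" "c \<in> V" "d \<in> W"
  shows "\<not> (pos a < pos b \<and> pos b < pos c \<and> pos c < pos d)"
  using assms unfolding noncrossing_def by meson

text \<open>A crossing in \<open>Q\<close> would be carried by \<open>f\<close> to a crossing in
  \<open>P\<close>. Monotonicity is required only for points of different blocks, so
  \<open>f\<close> may identify points inside one block, as \<open>sblk\<close> does later.\<close>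

lemma noncrossing_transfer:
  assumes "noncrossing pos P"
    and h: "\<And>V. V \<in> Q \<Longrightarrow> h V \<in> P" "\<And>V x. V \<in> Q \<Longrightarrow> x \<in> V \<Longrightarrow> f x \<in> h V"
    and inj: "inj_on h Q"
    and less: "\<And>V W x y. V \<in> Q \<Longrightarrow> W \<in> Q \<Longrightarrow> V \<noteq> W \<Longrightarrow> x \<in> V \<Longrightarrow> y \<in> W \<Longrightarrow>
      pos' x < pos' y \<Longrightarrow> pos (f x) < pos (f y)"
  shows "noncrossing pos' Q"
  unfolding noncrossing_def
proof (intro ballI impI notI)
  fix V W assume VW: "V \<in> Q" "W \<in> Q" "V \<noteq> W"
    and "\<exists>a\<in>V. \<exists>b\<in>W. \<exists>c\<in>V. \<exists>d\<in>W. pos' a < pos' b \<and> pos' b < pos' c \<and> pos' c < pos' d"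
  then obtain a b c d where abcd: "a \<in> V" "b \<in> W" "c \<in> V" "d \<in> W"
    "pos' a < pos' b" "pos' b < pos' c" "pos' c < pos' d" by blast
  have "h V \<noteq> h W" using inj VW by (auto dest: inj_onD)
  moreover have "pos (f a) < pos (f b)" "pos (f b) < pos (f c)" "pos (f c) < pos (f d)"
    using VW abcd less by metis+
  ultimately show False
    using noncrossingD[OF assms(1), of "h V" "h W" "f a" "f b" "f c" "f d"] h VW abcd by blast
qed

text \<open>Cutting a circle at another point moves the initial segment \<open>low\<close> behind the other points.\<close>

lemma noncrossing_cut:
  assumes nc: "noncrossing pos P"
    and low: "\<And>x y. x \<in> \<Union>P \<Longrightarrow> y \<in> \<Union>P \<Longrightarrow> low y \<Longrightarrow> \<not> low x \<Longrightarrow> pos y < pos x"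
    and less: "\<And>x y. x \<in> \<Union>P \<Longrightarrow> y \<in> \<Union>P \<Longrightarrow> pos' x < pos' y \<Longrightarrow>
      (low x \<longleftrightarrow> low y) \<and> pos x < pos y \<or> \<not> low x \<and> low y"
  shows "noncrossing pos' P"
  unfolding noncrossing_def
proof (intro ballI impI notI)
  fix V W assume VW: "V \<in> P" "W \<in> P" "V \<noteq> W"
    and "\<exists>a\<in>V. \<exists>b\<in>W. \<exists>c\<in>V. \<exists>d\<in>W. pos' a < pos' b \<and> pos' b < pos' c \<and> pos' c < pos' d"
  then obtain a b c d where abcd: "a \<in> V" "b \<in> W" "c \<in> V" "d \<in> W"
    "pos' a < pos' b" "pos' b < pos' c" "pos' c < pos' d" by blast
  have in_P: "a \<in> \<Union>P" "b \<in> \<Union>P" "c \<in> \<Union>P" "d \<in> \<Union>P" using VW abcd by auto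
  have l: "(low a \<longleftrightarrow> low b) \<and> pos a < pos b \<or> \<not> low a \<and> low b"
    "(low b \<longleftrightarrow> low c) \<and> pos b < pos c \<or> \<not> low b \<and> low c"
    "(low c \<longleftrightarrow> low d) \<and> pos c < pos d \<or> \<not> low c \<and> low d"
    using in_P abcd less by metis+
  have da: "low d \<Longrightarrow> \<not> low a \<Longrightarrow> pos d < pos a" using low in_P by blast
  note nc1 = noncrossingD[OF nc VW] and nc2 = noncrossingD[OF nc VW(2,1) VW(3)[symmetric]]
  \<comment> \<open>These are the four cyclic rotations of the pattern \<open>a, b, c, d\<close>.
    Along \<open>pos'\<close> the predicate \<open>low\<close> switches at most once, from false to
    true, so the order along \<open>pos\<close> is one of these rotations.\<close>
  have "\<not> (pos a < pos b \<and> pos b < pos c \<and> pos c < pos d)"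
    "\<not> (pos c < pos d \<and> pos d < pos a \<and> pos a < pos b)"
    "\<not> (pos d < pos a \<and> pos a < pos b \<and> pos b < pos c)"
    "\<not> (pos b < pos c \<and> pos c < pos d \<and> pos d < pos a)"
    using nc1[of a b c d] nc1[of c d a b] nc2[of d a b c] nc2[of b c d a] abcd(1-4) by blast+
  then show False using l da by (cases "low a"; cases "low b"; cases "low c"; cases "low d") auto
qed

text \<open>The circle \<open>1, \<dots>, n\<close> cut open in front of \<open>v\<close>: \<open>rot n v\<close> lists its points in the resulting
  linear order, and \<open>cpos n v\<close> gives positions that increase along this order.\<close>

definition rot :: "nat \<Rightarrow> nat \<Rightarrow> nat list" where
  "rot n v = [v..<Suc n] @ [1..<v]"

definition cpos :: "nat \<Rightarrow> nat \<Rightarrow> nat \<Rightarrow> nat" where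
  "cpos n v i = (if i < v then n + i else i)"

lemma set_rot: "1 \<le> v \<Longrightarrow> v \<le> n \<Longrightarrow> set (rot n v) = {1..n}"
  by (auto simp: rot_def)

lemma distinct_rot: "distinct (rot n v)"
  by (auto simp: rot_def)

lemma sorted_rot: "v \<le> n \<Longrightarrow> sorted_wrt (\<lambda>i j. cpos n v i < cpos n v j) (rot n v)"
proof -
  have "sorted_wrt (\<lambda>i j. cpos n v i < cpos n v j) [v..<Suc n]"
    by (rule sorted_wrt_mono_rel[OF _ sorted_wrt_upt]) (auto simp: cpos_def)
  moreover have "sorted_wrt (\<lambda>i j. cpos n v i < cpos n v j) [1..<v]"
    by (rule sorted_wrt_mono_rel[OF _ sorted_wrt_upt]) (auto simp: cpos_def)
  ultimately show ?thesis
    by (auto simp: rot_def sorted_wrt_append cpos_def simp del: upt_Suc)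
qed

lemma noncrossing_cpos:
  assumes "\<Union>P \<subseteq> {1..n}" "v \<le> n"
  shows "noncrossing (cpos n v) P \<longleftrightarrow> noncrossing (\<lambda>i. i) P"
proof
  assume "noncrossing (cpos n v) P"
  \<comment> \<open>To undo the cut, the points from \<open>v\<close> on, which come first along
    \<open>cpos\<close>, are moved behind the points below \<open>v\<close>.\<close>
  then show "noncrossing (\<lambda>i. i) P"
  proof (rule noncrossing_cut[where low = "\<lambda>i. v \<le> i"])
    fix x y assume "x \<in> \<Union>P" "y \<in> \<Union>P" 
    then have "x \<in> {1..n}" "y \<in> {1..n}" using assms(1) by blast+
    then show "v \<le> y \<Longrightarrow> \<not> v \<le> x \<Longrightarrow> cpos n v y < cpos n v x" 
      and "x < y \<Longrightarrow> (v \<le> x) = (v \<le> y) \<and> cpos n v x < cpos n v y \<or> \<not> v \<le> x \<and> v \<le> y"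
      by (auto simp: cpos_def)
  qed
next
  assume "noncrossing (\<lambda>i. i) P"
  then show "noncrossing (cpos n v) P"
  proof (rule noncrossing_cut[where low = "\<lambda>i. i < v"])
    fix x y assume "x \<in> \<Union>P" "y \<in> \<Union>P" 
    then have "x \<in> {1..n}" "y \<in> {1..n}" using assms(1) by blast+
    then show "cpos n v x < cpos n v y \<Longrightarrow> (x < v) = (y < v) \<and> x < y \<or> \<not> x < v \<and> y < v"
      using assms(2) by (auto simp: cpos_def split: if_splits)
  qed auto
qed

section \<open>Arcs between cyclically consecutive points of a block\<close>

lemma in_takeWhile_upt:
  "w \<in> set (takeWhile Q [i..<j]) \<longleftrightarrow> i \<le> w \<and> w < j \<and> (\<forall>u. i \<le> u \<and> u \<le> w \<longrightarrow> Q u)"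
proof (induction j)
  case (Suc j)
  show ?case
  proof (cases "i \<le> j")
    case True
    show ?thesis
    proof (cases "\<forall>u\<in>set [i..<j]. Q u")
      case all: True
      have "takeWhile Q ([i..<j] @ [j]) = [i..<j] @ takeWhile Q [j]"
        by (rule takeWhile_append2) (use all in blast)
      then show ?thesis using True all by (auto simp: less_Suc_eq le_less)
    next
      case False
      then have "takeWhile Q [i..<Suc j] = takeWhile Q [i..<j]"
        using True by (auto simp: takeWhile_append)
      then show ?thesis using Suc.IH False by (auto simp: less_Suc_eq)
    qed
  qed auto
qed simp

text \<open>The two alternatives are a walk from \<open>v\<close> that meets \<open>w\<close> before
  passing \<open>n\<close>, and one that wraps around to \<open>1\<close> first.\<close>

lemma in_arc_iff:
  "w \<in> set (arc n U v) \<longleftrightarrow>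
    v < w \<and> w \<le> n \<and> (\<forall>u\<in>U. \<not> (v < u \<and> u \<le> w)) \<or>
    1 \<le> w \<and> w < v \<and> (\<forall>u\<in>U. \<not> (v < u \<and> u \<le> n) \<and> \<not> (1 \<le> u \<and> u \<le> w))"
proof -
  have "w \<in> set (arc n U v) \<longleftrightarrow> w \<in> set (takeWhile (\<lambda>i. i \<notin> U) [Suc v..<Suc n]) \<or>
    (\<forall>i\<in>set [Suc v..<Suc n]. i \<notin> U) \<and> w \<in> set (takeWhile (\<lambda>i. i \<notin> U) [1..<v])"
  proof (cases "\<forall>i\<in>set [Suc v..<Suc n]. i \<notin> U")
    case True
    then have tw: "takeWhile (\<lambda>i. i \<notin> U) [Suc v..<Suc n] = [Suc v..<Suc n]"
      by (metis takeWhile_eq_all_conv)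
    show ?thesis using True unfolding arc_def takeWhile_append tw by (auto simp del: upt_Suc)
  next
    case False
    then show ?thesis unfolding arc_def takeWhile_append by (auto simp del: upt_Suc)
  qed
  also have "\<dots> \<longleftrightarrow> v < w \<and> w \<le> n \<and> (\<forall>u\<in>U. \<not> (v < u \<and> u \<le> w)) \<or>
    1 \<le> w \<and> w < v \<and> (\<forall>u\<in>U. \<not> (v < u \<and> u \<le> n) \<and> \<not> (1 \<le> u \<and> u \<le> w))"
    unfolding in_takeWhile_upt by (auto simp: Suc_le_eq less_Suc_eq_le simp del: upt_Suc)
  finally show ?thesis .
qed

text \<open>The arc through \<open>w\<close> starts at the last point of \<open>U\<close> before
  \<open>w\<close> in the circular order. If no point of \<open>U\<close> is below \<open>w\<close>,
  this is \<open>Max U\<close>, reached backwards through the wrap.\<close>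

lemma arc_exists:
  assumes "U \<subseteq> {1..n}" "U \<noteq> {}" "w \<in> {1..n}" "w \<notin> U"
  shows "\<exists>v\<in>U. w \<in> set (arc n U v)"
proof (cases "\<exists>u\<in>U. u < w")
  case True
  define v where "v = Max {u\<in>U. u < w}"
  have fin: "finite {u\<in>U. u < w}" by auto
  have v: "v \<in> {u\<in>U. u < w}" unfolding v_def using fin True by (intro Max_in) auto
  have max: "u \<le> v" if "u \<in> U" "u < w" for u unfolding v_def using fin that by (intro Max_ge) auto
  have "w \<in> set (arc n U v)"
    unfolding in_arc_iff using v max assms by (metis (mono_tags, lifting) atLeastAtMost_iff le_neq_implies_less linorder_not_less mem_Collect_eq)
  then show ?thesis using v by auto
next
  case False
  define v where "v = Max U"
  have fin: "finite U" using assms(1) finite_subset by blast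
  have v: "v \<in> U" unfolding v_def using fin assms by (intro Max_in) auto
  have max: "u \<le> v" if "u \<in> U" for u unfolding v_def using fin that by (intro Max_ge) auto
  have gt: "w < u" if "u \<in> U" for u using False that assms(4) by (metis linorder_neqE_nat)
  have "w \<in> set (arc n U v)"
    unfolding in_arc_iff using v max gt assms(3) by (metis atLeastAtMost_iff linorder_not_less)
  then show ?thesis using v by auto
qed

lemma arc_unique:
  assumes "U \<subseteq> {1..n}" "v \<in> U" "v' \<in> U" "w \<in> set (arc n U v)" "w \<in> set (arc n U v')"
  shows "v = v'"
proof -
  have "v \<in> {1..n}" "v' \<in> {1..n}" using assms by auto
  then show ?thesis using assms(2-5) unfolding in_arc_iff
    by (metis atLeastAtMost_iff linorder_neqE_nat nless_le)
qed

text \<open>A block \<open>V \<noteq> U\<close> of a non-crossing partition lies in one arc of \<open>U\<close>, so every cut at a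
  point of \<open>U\<close> lists its elements in the same order.\<close>

lemma filter_rot_cut:
  assumes "P \<in> NC n" "U \<in> P" "V \<in> P" "U \<noteq> V" "v \<in> U" "v' \<in> U"
  shows "filter (\<lambda>i. i \<in> V) (rot n v) = filter (\<lambda>i. i \<in> V) (rot n v')"
proof -
  have part: "partition_on {1..n} P" and nc: "noncrossing (\<lambda>i. i) P"
    using assms(1) by (auto simp: NC_def)
  have *: "filter (\<lambda>i. i \<in> V) (rot n v) = filter (\<lambda>i. i \<in> V) (rot n v')"
    if v: "v \<in> U" "v' \<in> U" "v < v'" for v v'
  proof -
    have vn: "1 \<le> v" "v' \<le> n" using v assms(2) part unfolding partition_on_def by fastforce+
    have "v \<notin> V" "v' \<notin> V" using v assms part unfolding partition_on_def disjoint_def by blast+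
    have sub: "V \<subseteq> {v..<v'} \<or> V \<inter> {v..<v'} = {}"
    proof (rule ccontr)
      assume "\<not> ?thesis"
      then obtain x y where xy: "x \<in> V" "x \<in> {v..<v'}" "y \<in> V" "y \<notin> {v..<v'}" by blast
      then have "v < x" "x < v'" using \<open>v \<notin> V\<close> by (auto simp: le_less)
      moreover have "y < v \<or> v' < y" using xy \<open>v' \<notin> V\<close> by (auto simp: not_le not_less le_less)
      ultimately show False 
        using noncrossingD[OF nc assms(2-4) v(1) xy(1) v(2) xy(3)]
          noncrossingD[OF nc assms(3,2) assms(4)[symmetric] xy(3) v(1) xy(1) v(2)] v(3) by blast
    qed
    \<comment> \<open>Passing from the cut at \<open>v\<close> to the cut at \<open>v'\<close> moves
      the segment \<open>[v..<v']\<close> from the front to the end. This is invisible for a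
      \<open>V\<close> that lies inside the segment or misses it.\<close>
    have 1: "[v..<Suc n] = [v..<v'] @ [v'..<Suc n]" "[1..<v'] = [1..<v] @ [v..<v']"
      using v(3) vn by (metis le_Suc_eq le_add_diff_inverse less_imp_le upt_add_eq_append order_trans)+
    from sub show ?thesis
    proof
      assume "V \<subseteq> {v..<v'}"
      then have "filter (\<lambda>i. i \<in> V) [v'..<Suc n] = []" "filter (\<lambda>i. i \<in> V) [1..<v] = []"
        by (auto simp: filter_empty_conv simp del: upt_Suc)
      then show ?thesis unfolding rot_def 1 by (simp del: upt_Suc)
    next
      assume "V \<inter> {v..<v'} = {}"
      then have "filter (\<lambda>i. i \<in> V) [v..<v'] = []"
        by (auto simp: filter_empty_conv)
      then show ?thesis unfolding rot_def 1 by (simp del: upt_Suc)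
    qed
  qed
  show ?thesis using *[OF assms(5,6)] *[OF assms(6,5)] by (metis linorder_neqE_nat)
qed

text \<open>A linear substitute for \<open>cyclic_subword\<close>: it depends on a cut point instead
  of a block, so that blocks can be refined and sums reindexed without carrying along the choice of
  an arc.\<close>

definition cword :: "nat \<Rightarrow> (nat \<Rightarrow> 'a) \<Rightarrow> nat \<Rightarrow> nat set \<Rightarrow> 'a list" where
  "cword n a v V = map a (filter (\<lambda>i. i \<in> V) (rot n v))"

text \<open>Non-crossing forces all of \<open>V\<close> into the arc that contains one of its
  points, which resolves the definite description in \<open>cyclic_subword\<close>. That arc is read
  off from the cut at its starting point, and \<open>filter_rot_cut\<close> moves the cut to any
  other point of \<open>U\<close>.\<close>

lemma cyclic_subword_eq_cword:
  assumes P: "P \<in> NC n" "U \<in> P" "V \<in> P" "U \<noteq> V" and u: "u \<in> U"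
  shows "cyclic_subword n a U V = cword n a u V"
proof -
  have part: "partition_on {1..n} P" and nc: "noncrossing (\<lambda>i. i) P"
    using assms(1) by (auto simp: NC_def)
  have sub: "U \<subseteq> {1..n}" "V \<subseteq> {1..n}" "V \<noteq> {}" "U \<inter> V = {}"
    using part P unfolding partition_on_def disjoint_def by blast+
  obtain w where w: "w \<in> V" using sub by auto
  obtain v where v: "v \<in> U" "w \<in> set (arc n U v)"
    using arc_exists[of U n w] sub w u by blast
  have in_arc: "x \<in> set (arc n U v)" if x: "x \<in> V" for x
  proof -
    obtain v' where v': "v' \<in> U" "x \<in> set (arc n U v')"
      using arc_exists[of U n x] sub x u by blast
    have bd: "v \<in> {1..n}" "v' \<in> {1..n}" "w \<in> {1..n}" "x \<in> {1..n}" using sub v v' w x by blast+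
    have ncUV: "\<not> (c < d \<and> d < e \<and> e < f)" "\<not> (d < c \<and> c < f \<and> f < e)"
      if "c \<in> U" "d \<in> V" "e \<in> U" "f \<in> V" for c d e f
      using noncrossingD[OF nc P(2,3,4)] noncrossingD[OF nc P(3,2) P(4)[symmetric]] that by blast+
    have "v = v'"
    proof (rule ccontr)
      assume ne: "v \<noteq> v'"
      \<comment> \<open>Each of \<open>w\<close> and \<open>x\<close> lies in its arc either before
        or after the wrap at \<open>n\<close>. If both lie after it, \<open>v\<close> and
        \<open>v'\<close> cannot be distinct; the other cases produce a crossing of \<open>U\<close>
        and \<open>V\<close>.\<close>
      consider (a) "v < w" "v' < x" | (b) "v < w" "x < v'" | (c) "w < v" "v' < x" | (d) "w < v" "x < v'"
        using v(2) v'(2) unfolding in_arc_iff by blast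
      then show False
      proof cases
        case a
        then have "\<not> (v < v' \<and> v' \<le> w)" "\<not> (v' < v \<and> v \<le> x)"
          using v v' unfolding in_arc_iff by auto
        with a ne have "v < w \<and> w < v' \<and> v' < x \<or> v' < x \<and> x < v \<and> v < w" by linarith
        then show False using ncUV v v' w x by blast
      next
        case b
        then have "\<not> (v < v' \<and> v' \<le> w)" "\<not> (v' < v)" "\<not> v \<le> x"
          using v v' bd unfolding in_arc_iff by auto
        with b ne have "x < v \<and> v < w \<and> w < v'" by linarith
        then show False using ncUV v v' w x by blast
      next
        case c
        then have "\<not> (v' < v \<and> v \<le> x)" "\<not> (v < v')" "\<not> v' \<le> w"
          using v v' bd unfolding in_arc_iff by auto
        with c ne have "w < v' \<and> v' < x \<and> x < v" by linarith
        then show False using ncUV v v' w x by blast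
      next
        case d
        then have "\<not> v < v'" "\<not> v' < v"
          using v v' bd unfolding in_arc_iff by auto
        with ne show False by simp
      qed
    qed
    then show ?thesis using v' by simp
  qed
  have "(THE v. v \<in> U \<and> V \<subseteq> set (arc n U v)) = v"
  proof (rule the_equality)
    show "v \<in> U \<and> V \<subseteq> set (arc n U v)" using v in_arc by auto
    show "v' = v" if "v' \<in> U \<and> V \<subseteq> set (arc n U v')" for v'
      using arc_unique[OF sub(1)] that w v by blast
  qed
  then have "cyclic_subword n a U V = map a (filter (\<lambda>i. i \<in> V) (arc n U v))"
    by (simp add: cyclic_subword_def)
  also have "filter (\<lambda>i. i \<in> V) (arc n U v) = filter (\<lambda>i. i \<in> V) (rot n v)"
  proof -
    define xs where "xs = [Suc v..<Suc n] @ [1..<v]"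
    have rot: "rot n v = v # xs" using v sub unfolding rot_def xs_def
      by (subst upt_conv_Cons) (auto simp: subset_iff simp del: upt_Suc)
    \<comment> \<open>\<open>xs\<close> is the cut circle without its first point \<open>v\<close>.
      The arc is an initial segment of it, and by distinctness no point of \<open>V\<close> is left
      in the rest.\<close>
    have xs: "xs = arc n U v @ dropWhile (\<lambda>i. i \<notin> U) xs"
      unfolding arc_def xs_def by (rule takeWhile_dropWhile_id[symmetric])
    have "distinct xs" using distinct_rot[of n v] rot by simp
    then have "set (arc n U v) \<inter> set (dropWhile (\<lambda>i. i \<notin> U) xs) = {}"
      by (subst (asm) xs) simp
    then have "filter (\<lambda>i. i \<in> V) (dropWhile (\<lambda>i. i \<notin> U) xs) = []"
      using in_arc by (auto simp: filter_empty_conv)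
    then have "filter (\<lambda>i. i \<in> V) xs = filter (\<lambda>i. i \<in> V) (arc n U v)"
      by (subst xs) simp
    moreover have "v \<notin> V" using v sub by blast
    ultimately show ?thesis by (simp add: rot)
  qed
  also have "\<dots> = filter (\<lambda>i. i \<in> V) (rot n u)"
    by (rule filter_rot_cut[OF P v(1) u])
  finally show ?thesis by (simp add: cword_def)
qed

section \<open>Moment-cumulant formulas on subsets of the circle\<close>

lemma sorted_wrt_key_unique:
  fixes k :: "'b \<Rightarrow> 'c::linorder"
  assumes "sorted_wrt (\<lambda>x y. k x < k y) xs" "sorted_wrt (\<lambda>x y. k x < k y) ys" "set xs = set ys"
  shows "xs = ys"
proof -
  have s: "sorted_wrt (<) (map k xs)" "sorted_wrt (<) (map k ys)"
    using assms by (simp_all add: sorted_wrt_map)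
  have "map k xs = map k ys"
    by (rule strict_sorted_equal[OF s(2,1)]) (simp add: assms(3))
  moreover have "inj_on k (set xs)"
    using s(1) strict_sorted_iff distinct_map by blast
  ultimately show ?thesis using assms(3) by (auto dest!: map_inj_on simp: Un_absorb)
qed

lemma partition_on_bij_betw:
  assumes "bij_betw f A B" "partition_on A P"
  shows "partition_on B ((`) f ` P)"
proof -
  have "{} \<notin> (`) f ` P" using partition_onD3[OF assms(2)] by auto
  then show ?thesis
    using partition_on_inj_image[OF assms(2) bij_betw_imp_inj_on[OF assms(1)]]
    by (simp add: bij_betw_imp_surj_on[OF assms(1)])
qed

definition NC_on :: "nat set \<Rightarrow> nat set set set" where
  "NC_on V = {P. partition_on V P \<and> noncrossing (\<lambda>i. i) P}"

lemma finite_NC_on: "finite V \<Longrightarrow> finite (NC_on V)"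
  by (rule finite_subset[of _ "Pow (Pow V)"]) (auto simp: NC_on_def partition_on_def)

text \<open>The enumeration increases along the circle cut at \<open>v\<close> and need not increase
  in the natural order. It preserves non-crossing partitions nevertheless, because crossing does not
  depend on the cut.\<close>

lemma NC_reindex:
  assumes bij: "bij_betw f {1..m} V" and V: "V \<subseteq> {1..n}" and v: "v \<le> n"
    and mono: "\<And>i j. i \<in> {1..m} \<Longrightarrow> j \<in> {1..m} \<Longrightarrow> i < j \<Longrightarrow> cpos n v (f i) < cpos n v (f j)"
  shows "bij_betw (\<lambda>P. (`) f ` P) (NC m) (NC_on V)"
proof -
  define g where "g = inv_into {1..m} f"
  have bij': "bij_betw g V {1..m}" unfolding g_def by (rule bij_betw_inv_into[OF bij])
  have gf: "g (f i) = i" if "i \<in> {1..m}" for i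
    unfolding g_def using bij that by (simp add: bij_betw_inv_into_left)
  have fg: "f (g x) = x" if "x \<in> V" for x
    unfolding g_def using bij that by (simp add: bij_betw_inv_into_right)
  have gV: "g x \<in> {1..m}" if "x \<in> V" for x using bij' that by (auto dest: bij_betwE)
  have fm: "f i \<in> V" if "i \<in> {1..m}" for i using bij that by (auto dest: bij_betwE)
  have gfW: "g ` f ` W = W" if "W \<subseteq> {1..m}" for W
    unfolding image_image using gf that by (simp add: subset_iff cong: image_cong)
  have fgW: "f ` g ` W = W" if "W \<subseteq> V" for W
    unfolding image_image using fg that by (simp add: subset_iff cong: image_cong)
  show ?thesis
  proof (rule bij_betw_byWitness[where f' = "\<lambda>P. (`) g ` P"])
    show "\<forall>P\<in>NC m. (`) g ` ((`) f ` P) = P"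
    proof
      fix P assume "P \<in> NC m"
      then have "g ` f ` W = W" if "W \<in> P" for W
        using that by (intro gfW) (auto simp: NC_def partition_on_def)
      then show "(`) g ` ((`) f ` P) = P"
        unfolding image_image[of "(`) g"] by (simp cong: image_cong)
    qed
    show "\<forall>P\<in>NC_on V. (`) f ` ((`) g ` P) = P"
    proof
      fix P assume "P \<in> NC_on V"
      then have "f ` g ` W = W" if "W \<in> P" for W
        using that by (intro fgW) (auto simp: NC_on_def partition_on_def)
      then show "(`) f ` ((`) g ` P) = P"
        unfolding image_image[of "(`) f"] by (simp cong: image_cong)
    qed
    show "(\<lambda>P. (`) f ` P) ` NC m \<subseteq> NC_on V"
    proof clarify
      fix P assume P: "P \<in> NC m"
      then have part: "partition_on {1..m} P" and nc: "noncrossing (\<lambda>i. i) P"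
        by (auto simp: NC_def)
      have part': "partition_on V ((`) f ` P)"
        by (rule partition_on_bij_betw[OF bij part])
      then have sub: "\<Union>((`) f ` P) = V" by (simp add: partition_on_def)
      have gfP: "g ` f ` W = W" if "W \<in> P" for W
        using that part by (intro gfW) (auto simp: partition_on_def)
      have "noncrossing (cpos n v) ((`) f ` P)"
      proof (rule noncrossing_transfer[OF nc, where h = "(`) g" and f = g])
        show "inj_on ((`) g) ((`) f ` P)" 
          by (rule inj_on_inverseI[where g = "(`) f"]) (elim imageE, simp only: gfP)
        show "g ` W \<in> P" if W: "W \<in> (`) f ` P" for W
          using W by (rule imageE) (simp add: gfP)
        fix A B x y assume "A \<in> (`) f ` P" "B \<in> (`) f ` P" "x \<in> A" "y \<in> B" "cpos n v x < cpos n v y"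
        then have xy: "x \<in> V" "y \<in> V" using sub by blast+
        have "g x \<noteq> g y"
          using fg[OF xy(1)] fg[OF xy(2)] \<open>cpos n v x < cpos n v y\<close> by (metis less_irrefl)
        moreover have "\<not> g y < g x"
          using mono[OF gV[OF xy(2)] gV[OF xy(1)]] \<open>cpos n v x < cpos n v y\<close>
          unfolding fg[OF xy(1)] fg[OF xy(2)] by linarith
        ultimately show "g x < g y" by linarith
      qed auto
      then have "noncrossing (\<lambda>i. i) ((`) f ` P)"
        using noncrossing_cpos[of "(`) f ` P" n v] V v unfolding sub by blast
      then show "(`) f ` P \<in> NC_on V" using part' by (simp add: NC_on_def)
    qed
    show "(\<lambda>P. (`) g ` P) ` NC_on V \<subseteq> NC m"
    proof clarify
      fix P assume P: "P \<in> NC_on V"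
      then have part: "partition_on V P" and nc: "noncrossing (\<lambda>i. i) P"
        by (auto simp: NC_on_def)
      have nc: "noncrossing (cpos n v) P"
        using noncrossing_cpos[of P n v] part V v nc by (simp add: partition_on_def)
      have part': "partition_on {1..m} ((`) g ` P)"
        by (rule partition_on_bij_betw[OF bij' part])
      then have sub: "\<Union>((`) g ` P) = {1..m}" by (simp add: partition_on_def)
      have fgP: "f ` g ` W = W" if "W \<in> P" for W
        using that part by (intro fgW) (auto simp: partition_on_def)
      have "noncrossing (\<lambda>i. i) ((`) g ` P)"
      proof (rule noncrossing_transfer[OF nc, where h = "(`) f" and f = f])
        show "inj_on ((`) f) ((`) g ` P)" 
          by (rule inj_on_inverseI[where g = "(`) g"]) (elim imageE, simp only: fgP)
        show "f ` W \<in> P" if W: "W \<in> (`) g ` P" for W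
          using W by (rule imageE) (simp add: fgP)
        fix A B x y assume "A \<in> (`) g ` P" "B \<in> (`) g ` P" "x \<in> A" "y \<in> B" "x < y"
        then show "cpos n v (f x) < cpos n v (f y)" using mono sub by blast
      qed auto
      then show "(`) g ` P \<in> NC m" using part' by (simp add: NC_def)
    qed
  qed
qed

lemma sorted_list_of_set_filter:
  assumes "W \<subseteq> {1..m}"
  shows "sorted_list_of_set W = filter (\<lambda>i. i \<in> W) [1..<Suc m]"
proof (rule sorted_wrt_key_unique[where k = "\<lambda>i. i"])
  have "finite W" using assms finite_subset by blast
  then show "set (sorted_list_of_set W) = set (filter (\<lambda>i. i \<in> W) [1..<Suc m])"
    using assms by auto
  show "sorted_wrt (<) (filter (\<lambda>i. i \<in> W) [1..<Suc m])"
    by (intro sorted_wrt_filter sorted_wrt_upt)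
qed simp

lemma subword_eq_cword: "V \<subseteq> {1..n} \<Longrightarrow> subword a V = cword n a 1 V"
  by (simp add: subword_def cword_def sorted_list_of_set_filter rot_def del: upt_Suc)

lemma filter_map_image:
  assumes "inj_on f A" "set xs \<subseteq> A" "W \<subseteq> A"
  shows "filter (\<lambda>x. x \<in> f ` W) (map f xs) = map f (filter (\<lambda>i. i \<in> W) xs)"
proof -
  have "f i \<in> f ` W \<longleftrightarrow> i \<in> W" if "i \<in> set xs" for i
    using assms that by (auto dest: inj_onD)
  then show ?thesis by (simp add: filter_map o_def cong: filter_cong)
qed

text \<open>The moment-cumulant formulas number the letters of a list from 1. This locale provides
  the renumbering of a subset of the circle, starting at the cut \<open>v\<close>, that carries them
  over to subsets.\<close>

locale circle_enum =
  fixes n v :: nat and V :: "nat set"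
  assumes V: "V \<subseteq> {1..n}" and v: "v \<in> {1..n}"
begin

definition L where "L = filter (\<lambda>i. i \<in> V) (rot n v)"
abbreviation m where "m \<equiv> length L"
abbreviation f where "f \<equiv> letter L"

lemma set_L: "set L = V"
  using V v by (auto simp: L_def set_rot)

lemma L_eq: "L = map f [1..<Suc m]"
  by (rule nth_equalityI) (auto simp: letter_def simp del: upt_Suc)

lemma mono: "i \<in> {1..m} \<Longrightarrow> j \<in> {1..m} \<Longrightarrow> i < j \<Longrightarrow> cpos n v (f i) < cpos n v (f j)"
proof -
  have "sorted_wrt (\<lambda>i j. cpos n v i < cpos n v j) L"
    unfolding L_def using v by (intro sorted_wrt_filter sorted_rot) auto
  then show "i \<in> {1..m} \<Longrightarrow> j \<in> {1..m} \<Longrightarrow> i < j \<Longrightarrow> cpos n v (f i) < cpos n v (f j)"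
    by (auto simp: letter_def sorted_wrt_iff_nth_less)
qed

lemma bij: "bij_betw f {1..m} V"
proof -
  have "f ` {1..m} = set (map f [1..<Suc m])"
    by (simp only: set_map set_upt atLeastLessThanSuc_atLeastAtMost)
  then have "f ` {1..m} = V" using L_eq set_L by metis
  moreover have "inj_on f {1..m}"
    using mono by (intro linorder_inj_onI') (metis less_irrefl)+
  ultimately show ?thesis by (simp add: bij_betw_def)
qed

lemma NC_bij: "bij_betw (\<lambda>P. (`) f ` P) (NC m) (NC_on V)"
  by (rule NC_reindex[OF bij V _ mono]) (use v in auto)

lemma cword_image:
  assumes "W \<subseteq> {1..m}"
  shows "cword n a v (f ` W) = subword (letter (map a L)) W"
proof -
  have "f ` W \<subseteq> V" using assms bij by (auto simp: bij_betw_def)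
  then have "filter (\<lambda>i. i \<in> f ` W) (rot n v) = filter (\<lambda>i. i \<in> f ` W) L"
    by (auto simp: L_def intro!: filter_cong)
  also have "\<dots> = filter (\<lambda>i. i \<in> f ` W) (map f [1..<Suc m])"
    using L_eq by simp
  also have "\<dots> = map f (filter (\<lambda>i. i \<in> W) [1..<Suc m])"
    by (rule filter_map_image[OF bij_betw_imp_inj_on[OF bij] _ assms]) auto
  finally show ?thesis
    using assms by (auto simp: cword_def subword_def sorted_list_of_set_filter letter_def simp del: upt_Suc)
qed

lemma big_op_image:
  assumes "P \<in> NC m"
  shows "(\<Prod>W\<in>(`) f ` P. F W) = (\<Prod>W\<in>P. F (f ` W))" "(\<Sum>W\<in>(`) f ` P. G W) = (\<Sum>W\<in>P. G (f ` W))"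
    "U \<in> P \<Longrightarrow> (\<Prod>W\<in>(`) f ` P - {f ` U}. F W) = (\<Prod>W\<in>P - {U}. F (f ` W))"
proof -
  have inj: "inj_on ((`) f) P"
    by (rule inj_on_subset[OF inj_on_image_Pow[OF bij_betw_imp_inj_on[OF bij]]])
      (use assms in \<open>auto simp: NC_def partition_on_def\<close>)
  then show "(\<Prod>W\<in>(`) f ` P. F W) = (\<Prod>W\<in>P. F (f ` W))" "(\<Sum>W\<in>(`) f ` P. G W) = (\<Sum>W\<in>P. G (f ` W))"
    by (simp_all add: prod.reindex sum.reindex)
  assume "U \<in> P"
  then have "(`) f ` P - {f ` U} = (`) f ` (P - {U})"
    using inj by (auto dest: inj_onD)
  then show "(\<Prod>W\<in>(`) f ` P - {f ` U}. F W) = (\<Prod>W\<in>P - {U}. F (f ` W))"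
    using inj_on_subset[OF inj, of "P - {U}"] by (simp add: prod.reindex)
qed

end

lemma moment_NC_on:
  assumes "V \<subseteq> {1..n}" "V \<noteq> {}" "v \<in> {1..n}"
  shows "\<psi> (prod_list (cword n a v V)) =
    (\<Sum>P\<in>NC_on V. \<Prod>W\<in>P. free_cumulant \<psi> (cword n a v W))"
proof -
  interpret circle_enum n v V using assms by unfold_locales
  have ne: "map a L \<noteq> []" using set_L assms(2) by auto
  have "cword n a v V = map a L" by (simp add: cword_def L_def)
  then have "\<psi> (prod_list (cword n a v V)) =
    (\<Sum>P\<in>NC m. \<Prod>W\<in>P. free_cumulant \<psi> (subword (letter (map a L)) W))"
    using moment_free_cumulant[OF ne, of \<psi>] by simp
  also have "\<dots> = (\<Sum>P\<in>NC m. \<Prod>W\<in>(`) f ` P. free_cumulant \<psi> (cword n a v W))"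
  proof (rule sum.cong[OF refl])
    fix P assume P: "P \<in> NC m"
    then have "W \<subseteq> {1..m}" if "W \<in> P" for W
      using that by (auto simp: NC_def partition_on_def)
    then show "(\<Prod>W\<in>P. free_cumulant \<psi> (subword (letter (map a L)) W)) =
      (\<Prod>W\<in>(`) f ` P. free_cumulant \<psi> (cword n a v W))"
      unfolding big_op_image(1)[OF P] by (intro prod.cong) (simp_all add: cword_image)
  qed
  also have "\<dots> = (\<Sum>P\<in>NC_on V. \<Prod>W\<in>P. free_cumulant \<psi> (cword n a v W))"
    by (rule sum.reindex_bij_betw[OF NC_bij])
  finally show ?thesis .
qed

text \<open>Every summand reads its words relative to its own block \<open>U\<close>, so the
  renumbering must be compatible with all cuts of the circle and not just with one.
  \<open>Min U\<close> is a convenient choice of a cut point in \<open>U\<close>.\<close>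

lemma cyclic_moment_NC_on:
  assumes "V \<subseteq> {1..n}" "V \<noteq> {}"
  shows "\<delta> (prod_list (subword a V)) =
    (\<Sum>P\<in>NC_on V. \<Sum>U\<in>P. cyclic_free_cumulant \<psi> \<delta> (subword a U) *
       (\<Prod>W\<in>P - {U}. free_cumulant \<psi> (cword n a (Min U) W)))"
proof -
  \<comment> \<open>Cutting at \<open>1\<close> enumerates \<open>V\<close> in its natural order,
    the one used by \<open>subword\<close>.\<close>
  interpret circle_enum n 1 V using assms by unfold_locales auto
  have mono': "f i < f j" if "i \<in> {1..m}" "j \<in> {1..m}" "i < j" for i j
  proof -
    have "f i \<in> V" "f j \<in> V" using that bij by (auto dest: bij_betwE)
    then have "1 \<le> f i" "1 \<le> f j" using V by auto
    then show ?thesis using mono[OF that] by (auto simp: cpos_def)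
  qed
  \<comment> \<open>Renumbering commutes with moving the cut: both sides list \<open>V\<close>
    increasingly along the circle cut at \<open>f i\<close>.\<close>
  have rot_f: "map f (rot m i) = filter (\<lambda>x. x \<in> V) (rot n (f i))" if i: "i \<in> {1..m}" for i
  proof (rule sorted_wrt_key_unique[where k = "cpos n (f i)"])
    have fi: "f i \<in> {1..n}" using bij_betw_apply[OF bij i] V by blast
    show "sorted_wrt (\<lambda>x y. cpos n (f i) x < cpos n (f i) y) (filter (\<lambda>x. x \<in> V) (rot n (f i)))"
      using fi by (intro sorted_wrt_filter sorted_rot) auto
    show "set (map f (rot m i)) = set (filter (\<lambda>x. x \<in> V) (rot n (f i)))"
      using bij_betw_imp_surj_on[OF bij] i fi V by (auto simp: set_rot)
    have "sorted_wrt (\<lambda>x y. cpos n (f i) (f x) < cpos n (f i) (f y)) (rot m i)"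
    proof (rule sorted_wrt_mono_rel[OF _ sorted_rot])
      fix x y assume "x \<in> set (rot m i)" "y \<in> set (rot m i)" and less: "cpos m i x < cpos m i y"
      then have xy: "x \<in> {1..m}" "y \<in> {1..m}" using i by (simp_all add: set_rot)
      then have "f x \<in> {1..n}" "f y \<in> {1..n}"
        using bij_betw_apply[OF bij] V by blast+
      moreover have "x < i \<longleftrightarrow> f x < f i" "y < i \<longleftrightarrow> f y < f i" "x < y \<longleftrightarrow> f x < f y"
        using mono' xy i by (metis linorder_neqE_nat order_less_asym)+
      ultimately show "cpos n (f i) (f x) < cpos n (f i) (f y)"
        using less xy by (auto simp: cpos_def split: if_splits)
    qed (use i in auto)
    then show "sorted_wrt (\<lambda>x y. cpos n (f i) x < cpos n (f i) y) (map f (rot m i))"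
      by (simp add: sorted_wrt_map)
  qed
  have ne: "map a L \<noteq> []" using set_L assms(2) by auto
  have "subword a V = map a L" using V by (simp only: subword_eq_cword cword_def L_def)
  then have "\<delta> (prod_list (subword a V)) =
    (\<Sum>P\<in>NC m. \<Sum>U\<in>P. cyclic_free_cumulant \<psi> \<delta> (subword (letter (map a L)) U) *
       (\<Prod>W\<in>P - {U}. free_cumulant \<psi> (cyclic_subword m (letter (map a L)) U W)))"
    using moment_cyclic_free_cumulant[OF ne, of \<delta> \<psi>] by simp
  also have "\<dots> = (\<Sum>P\<in>NC m. \<Sum>U\<in>(`) f ` P. cyclic_free_cumulant \<psi> \<delta> (subword a U) *
       (\<Prod>W\<in>(`) f ` P - {U}. free_cumulant \<psi> (cword n a (Min U) W)))"
  proof (rule sum.cong[OF refl])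
    fix P assume P: "P \<in> NC m"
    then have sub: "W \<subseteq> {1..m}" if "W \<in> P" for W
      using that by (auto simp: NC_def partition_on_def)
    have 1: "subword a (f ` U) = subword (letter (map a L)) U" if "U \<in> P" for U
    proof -
      have "f ` U \<subseteq> {1..n}" using sub[OF that] bij V by (auto dest: bij_betwE)
      then show ?thesis using cword_image[OF sub[OF that], of a] by (simp add: subword_eq_cword)
    qed
    have 2: "cword n a (Min (f ` U)) (f ` W) = cyclic_subword m (letter (map a L)) U W"
      if UW: "U \<in> P" "W \<in> P" "U \<noteq> W" for U W
    proof -
      have "U \<noteq> {}" using P UW by (auto simp: NC_def partition_on_def)
      moreover have "finite U" using sub[OF UW(1)] finite_subset by blast
      ultimately have "Min (f ` U) \<in> f ` U" by (intro Min_in) auto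
      then obtain u where u: "u \<in> U" "Min (f ` U) = f u" by auto
      have um: "u \<in> {1..m}" using sub UW u by blast
      have "f ` W \<subseteq> V" using sub[OF UW(2)] bij by (auto dest: bij_betwE)
      then have "filter (\<lambda>i. i \<in> f ` W) (rot n (f u)) = filter (\<lambda>i. i \<in> f ` W) (filter (\<lambda>x. x \<in> V) (rot n (f u)))"
        by (auto intro!: filter_cong)
      also have "\<dots> = filter (\<lambda>i. i \<in> f ` W) (map f (rot m u))"
        using rot_f[OF um] by simp
      also have "\<dots> = map f (filter (\<lambda>i. i \<in> W) (rot m u))"
        by (rule filter_map_image[OF bij_betw_imp_inj_on[OF bij] _ sub[OF UW(2)]])
          (use um in \<open>simp add: set_rot\<close>)
      finally have "cword n a (f u) (f ` W) = cword m (letter (map a L)) u W"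
        using um by (auto simp: cword_def letter_def set_rot)
      then show ?thesis
        unfolding cyclic_subword_eq_cword[OF P UW u(1)] u(2) .
    qed
    show "(\<Sum>U\<in>P. cyclic_free_cumulant \<psi> \<delta> (subword (letter (map a L)) U) *
       (\<Prod>W\<in>P - {U}. free_cumulant \<psi> (cyclic_subword m (letter (map a L)) U W))) =
       (\<Sum>U\<in>(`) f ` P. cyclic_free_cumulant \<psi> \<delta> (subword a U) *
       (\<Prod>W\<in>(`) f ` P - {U}. free_cumulant \<psi> (cword n a (Min U) W)))"
      unfolding big_op_image(2)[OF P]
    proof (rule sum.cong[OF refl])
      fix U assume U: "U \<in> P"
      show "cyclic_free_cumulant \<psi> \<delta> (subword (letter (map a L)) U) *
          (\<Prod>W\<in>P - {U}. free_cumulant \<psi> (cyclic_subword m (letter (map a L)) U W)) =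
        cyclic_free_cumulant \<psi> \<delta> (subword a (f ` U)) *
          (\<Prod>W\<in>(`) f ` P - {f ` U}. free_cumulant \<psi> (cword n a (Min (f ` U)) W))"
        unfolding big_op_image(3)[OF P U] 1[OF U]
        by (intro arg_cong2[where f = "(*)"] prod.cong refl) (metis 2[OF U] DiffD1 DiffD2 singletonI)
    qed
  qed
  also have "\<dots> = (\<Sum>P\<in>NC_on V. \<Sum>U\<in>P. cyclic_free_cumulant \<psi> \<delta> (subword a U) *
       (\<Prod>W\<in>P - {U}. free_cumulant \<psi> (cword n a (Min U) W)))"
    by (rule sum.reindex_bij_betw[OF NC_bij])
  finally show ?thesis .
qed

section \<open>Refinements of a rooted non-crossing partition\<close>

lemma partition_on_block_eq:
  "partition_on A P \<Longrightarrow> V \<in> P \<Longrightarrow> W \<in> P \<Longrightarrow> x \<in> V \<Longrightarrow> x \<in> W \<Longrightarrow> V = W"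
  by (auto simp: partition_on_def dest: disjointD)

lemma partition_on_obtains:
  assumes "partition_on A P" "x \<in> A"
  obtains V where "V \<in> P" "x \<in> V"
  using assms unfolding partition_on_def by blast

text \<open>A non-empty block of another \<open>F V'\<close> cannot fit into \<open>V\<close>, since
  the blocks of \<open>P\<close> are disjoint. Hence the glued partition determines the family
  \<open>F\<close>.\<close>

lemma refinement_blocks_within:
  assumes P: "partition_on A P" and F: "\<And>V. V \<in> P \<Longrightarrow> partition_on V (F V)" and V: "V \<in> P"
  shows "{W \<in> (\<Union>V\<in>P. F V). W \<subseteq> V} = F V"
proof (intro equalityI subsetI)
  fix W assume "W \<in> {W \<in> (\<Union>V\<in>P. F V). W \<subseteq> V}"
  then obtain V' where V': "V' \<in> P" "W \<in> F V'" "W \<subseteq> V" by auto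
  then have "W \<subseteq> V'" "W \<noteq> {}" using F[OF V'(1)] by (auto simp: partition_on_def)
  then have "V' = V" using partition_on_block_eq[OF P V'(1) V] V'(3) by blast
  then show "W \<in> F V" using V' by simp
next
  fix W assume "W \<in> F V"
  moreover from this have "W \<subseteq> V" using F[OF V] by (auto simp: partition_on_def)
  ultimately show "W \<in> {W \<in> (\<Union>V\<in>P. F V). W \<subseteq> V}" using V by blast
qed

text \<open>The lower interval of \<open>P\<close> is a product over its blocks. Gluing creates no
  crossing: inside one \<open>V\<close> there is none by the choice of \<open>F V\<close>, and a
  crossing of pieces of different blocks would be a crossing of \<open>P\<close>.\<close>

lemma NC_refinements_bij:
  assumes P: "P \<in> NC n"
  shows "bij_betw (\<lambda>F. \<Union>V\<in>P. F V) (PiE P NC_on) {S \<in> NC n. refines {1..n} S P}"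
proof (rule bij_betw_byWitness[where f' = "\<lambda>S. \<lambda>V\<in>P. {W \<in> S. W \<subseteq> V}"])
  have part: "partition_on {1..n} P" and nc: "noncrossing (\<lambda>i. i) P"
    using P by (auto simp: NC_def)
  have FV: "partition_on V (F V)" if "F \<in> PiE P NC_on" "V \<in> P" for F V
    using PiE_mem[OF that] by (simp add: NC_on_def)
  show "\<forall>F\<in>PiE P NC_on. (\<lambda>V\<in>P. {W \<in> (\<Union>V\<in>P. F V). W \<subseteq> V}) = F"
  proof
    fix F assume F: "F \<in> PiE P NC_on"
    show "(\<lambda>V\<in>P. {W \<in> (\<Union>V\<in>P. F V). W \<subseteq> V}) = F"
    proof
      fix V
      show "(\<lambda>V\<in>P. {W \<in> (\<Union>V\<in>P. F V). W \<subseteq> V}) V = F V"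
        using refinement_blocks_within[OF part FV[OF F], of V] PiE_arb[OF F] by (cases "V \<in> P") auto
    qed
  qed
  show "\<forall>S\<in>{S \<in> NC n. refines {1..n} S P}. (\<Union>V\<in>P. (\<lambda>V\<in>P. {W \<in> S. W \<subseteq> V}) V) = S"
    by (auto simp: refines_def)
  show "(\<lambda>F. \<Union>V\<in>P. F V) ` PiE P NC_on \<subseteq> {S \<in> NC n. refines {1..n} S P}"
  proof clarify
    fix F assume F: "F \<in> PiE P NC_on"
    have sub: "W \<subseteq> V" "W \<noteq> {}" if "V \<in> P" "W \<in> F V" for V W
      using FV[OF F that(1)] that(2) by (auto simp: partition_on_def)
    have "partition_on {1..n} (\<Union>V\<in>P. F V)"
    proof (rule partition_onI)
      have "\<Union>(F V) = V" if "V \<in> P" for V using FV[OF F that] by (simp add: partition_on_def)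
      then have "(\<Union>V\<in>P. \<Union>(F V)) = \<Union>P" by simp
      then have "\<Union>(\<Union>V\<in>P. F V) = \<Union>P" by blast
      then show "\<Union>(\<Union>V\<in>P. F V) = {1..n}" using part by (simp add: partition_on_def)
      show "{} \<notin> (\<Union>V\<in>P. F V)" using sub by blast
      fix p q assume "p \<in> (\<Union>V\<in>P. F V)" "q \<in> (\<Union>V\<in>P. F V)" "p \<noteq> q"
      then obtain V V' where V: "V \<in> P" "p \<in> F V" "V' \<in> P" "q \<in> F V'" by blast
      show "disjnt p q"
      proof (cases "V = V'")
        case True
        then show ?thesis using FV[OF F V(1)] V \<open>p \<noteq> q\<close> by (auto simp: partition_on_def disjnt_def dest: disjointD)
      next
        case False
        then show ?thesis using partition_on_block_eq[OF part V(1,3)] sub[OF V(1,2)] sub[OF V(3,4)]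
          unfolding disjnt_iff by blast
      qed
    qed
    moreover have "noncrossing (\<lambda>i. i) (\<Union>V\<in>P. F V)"
      unfolding noncrossing_def
    proof (intro ballI impI notI)
      fix p q assume "p \<in> (\<Union>V\<in>P. F V)" "q \<in> (\<Union>V\<in>P. F V)" and ne: "p \<noteq> q"
        and cr: "\<exists>a\<in>p. \<exists>b\<in>q. \<exists>c\<in>p. \<exists>d\<in>q. a < b \<and> b < c \<and> c < d"
      then obtain V V' where V: "V \<in> P" "p \<in> F V" "V' \<in> P" "q \<in> F V'" by blast
      obtain a b c d where abcd: "a \<in> p" "b \<in> q" "c \<in> p" "d \<in> q" "a < b \<and> b < c \<and> c < d"
        using cr by blast
      show False
      proof (cases "V = V'")
        case True
        then have "noncrossing (\<lambda>i. i) (F V)" using PiE_mem[OF F V(1)] by (simp add: NC_on_def)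
        from noncrossingD[OF this, of p q] V True ne abcd show False by blast
      next
        case False
        from noncrossingD[OF nc V(1,3) False, of a b c d] sub[OF V(1,2)] sub[OF V(3,4)] abcd
        show False by blast
      qed
    qed
    moreover have "\<exists>V\<in>P. W \<subseteq> V" if "W \<in> (\<Union>V\<in>P. F V)" for W using that sub by blast
    ultimately show "(\<Union>V\<in>P. F V) \<in> NC n \<and> refines {1..n} (\<Union>V\<in>P. F V) P"
      using part unfolding NC_def refines_def by blast
  qed
  show "(\<lambda>S. \<lambda>V\<in>P. {W \<in> S. W \<subseteq> V}) ` {S \<in> NC n. refines {1..n} S P} \<subseteq> PiE P NC_on"
  proof clarify
    fix S assume S: "S \<in> NC n" "refines {1..n} S P"
    have partS: "partition_on {1..n} S" and ncS: "noncrossing (\<lambda>i. i) S"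
      using S by (auto simp: NC_def)
    have "{W \<in> S. W \<subseteq> V} \<in> NC_on V" if V: "V \<in> P" for V
    proof -
      have cover: "\<exists>W\<in>S. W \<subseteq> V \<and> x \<in> W" if x: "x \<in> V" for x
      proof -
        have "x \<in> {1..n}" using x V part by (auto simp: partition_on_def)
        then obtain W where W: "W \<in> S" "x \<in> W" by (rule partition_on_obtains[OF partS])
        then obtain V' where V': "V' \<in> P" "W \<subseteq> V'" using S(2) by (auto simp: refines_def)
        then have "V' = V" using partition_on_block_eq[OF part] W x V by blast
        then show ?thesis using W V' by blast
      qed
      have "partition_on V {W \<in> S. W \<subseteq> V}"
      proof (rule partition_onI)
        show "\<Union>{W \<in> S. W \<subseteq> V} = V" using cover by blast
      qed (use partS in \<open>auto simp: partition_on_def disjnt_def dest: disjointD\<close>)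
      moreover have "noncrossing (\<lambda>i. i) {W \<in> S. W \<subseteq> V}"
        by (rule noncrossing_transfer[OF ncS, where h = id and f = id]) auto
      ultimately show ?thesis by (simp add: NC_on_def)
    qed
    then show "(\<lambda>V\<in>P. {W \<in> S. W \<subseteq> V}) \<in> PiE P NC_on" by simp
  qed
qed

text \<open>Only a part \<open>W\<close> of the block \<open>V\<close> is read. This is the
  situation after \<open>P\<close> has been refined while the cut still runs through a point of
  \<open>U\<close>.\<close>

lemma cword_cong:
  assumes P: "P \<in> NC n" "U \<in> P" "V \<in> P" "U \<noteq> V" "u \<in> U" "u' \<in> U" and W: "W \<subseteq> V"
  shows "cword n a u W = cword n a u' W"
proof -
  have "filter (\<lambda>i. i \<in> W) (rot n v) = filter (\<lambda>i. i \<in> W) (filter (\<lambda>i. i \<in> V) (rot n v))" for v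
    using W by (auto intro!: filter_cong)
  then show ?thesis
    using filter_rot_cut[OF P] unfolding cword_def by metis
qed

text \<open>Each factor is expanded on its own: the root \<open>U\<^sub>0\<close> by the cyclic
  moment formula, every other block by the ordinary one. The former also selects a new root
  \<open>U\<close> inside \<open>U\<^sub>0\<close>, which is the origin of the inner sum. The
  choices for all blocks are glued by \<open>NC_refinements_bij\<close>.\<close>

lemma rooted_moment_expansion:
  assumes P: "P \<in> NC n" and root: "U\<^sub>0 \<in> P"
  shows "\<delta> (prod_list (subword a U\<^sub>0)) * (\<Prod>V\<in>P - {U\<^sub>0}. \<psi> (prod_list (cyclic_subword n a U\<^sub>0 V))) =
    (\<Sum>S | S \<in> NC n \<and> refines {1..n} S P. \<Sum>U | U \<in> S \<and> U \<subseteq> U\<^sub>0.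
       cyclic_free_cumulant \<psi> \<delta> (subword a U) *
       (\<Prod>W\<in>S - {U}. free_cumulant \<psi> (cyclic_subword n a U W)))"
    (is "?lhs = (\<Sum>S | _. \<Sum>U | _. ?D U * (\<Prod>W\<in>S - {U}. ?C U W))")
proof -
  have part: "partition_on {1..n} P" using P by (auto simp: NC_def)
  have finP: "finite P" using part finite_elements by blast
  have sub: "V \<subseteq> {1..n}" "V \<noteq> {}" "finite V" if "V \<in> P" for V
    using that part NC_block_finite[OF P that] by (auto simp: partition_on_def)
  define u\<^sub>0 where "u\<^sub>0 = Min U\<^sub>0"
  have u0: "u\<^sub>0 \<in> U\<^sub>0" unfolding u\<^sub>0_def using sub[OF root] by (intro Min_in)
  define \<kappa> where "\<kappa> u W = free_cumulant \<psi> (cword n a u W)" for u W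
  \<comment> \<open>The contribution of \<open>V\<close> once it has been refined to
    \<open>\<rho>\<close>. Blocks other than the root are read from the fixed cut point
    \<open>u\<^sub>0\<close>, before any new root is known.\<close>
  define h where "h V \<rho> = (if V = U\<^sub>0 then \<Sum>U\<in>\<rho>. ?D U * (\<Prod>W\<in>\<rho> - {U}. \<kappa> (Min U) W)
    else \<Prod>W\<in>\<rho>. \<kappa> u\<^sub>0 W)" for V \<rho>
  have "\<psi> (prod_list (cyclic_subword n a U\<^sub>0 V)) = (\<Sum>\<rho>\<in>NC_on V. h V \<rho>)" if V: "V \<in> P - {U\<^sub>0}" for V
  proof -
    have "cyclic_subword n a U\<^sub>0 V = cword n a u\<^sub>0 V"
      using V by (intro cyclic_subword_eq_cword[OF P root _ _ u0]) auto
    moreover have "\<psi> (prod_list (cword n a u\<^sub>0 V)) = (\<Sum>\<rho>\<in>NC_on V. \<Prod>W\<in>\<rho>. \<kappa> u\<^sub>0 W)"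
      unfolding \<kappa>_def using V sub u0 root by (intro moment_NC_on) blast+
    ultimately show ?thesis using V by (simp add: h_def)
  qed
  moreover have "\<delta> (prod_list (subword a U\<^sub>0)) = (\<Sum>\<rho>\<in>NC_on U\<^sub>0. h U\<^sub>0 \<rho>)"
    using cyclic_moment_NC_on[OF sub(1,2)[OF root], of \<delta> a \<psi>] by (simp add: h_def \<kappa>_def)
  ultimately have "?lhs = (\<Prod>V\<in>P. \<Sum>\<rho>\<in>NC_on V. h V \<rho>)"
    using prod.remove[OF finP root, of "\<lambda>V. \<Sum>\<rho>\<in>NC_on V. h V \<rho>"] by simp
  also have "\<dots> = (\<Sum>F\<in>PiE P NC_on. \<Prod>V\<in>P. h V (F V))"
    using sub(3) by (intro prod_sum_PiE finP finite_NC_on)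
  also have "\<dots> = (\<Sum>F\<in>PiE P NC_on. \<Sum>U | U \<in> (\<Union>V\<in>P. F V) \<and> U \<subseteq> U\<^sub>0.
    ?D U * (\<Prod>W\<in>(\<Union>V\<in>P. F V) - {U}. ?C U W))"
  proof (rule sum.cong[OF refl])
    fix F assume F: "F \<in> PiE P NC_on"
    define S where "S = (\<Union>V\<in>P. F V)"
    have SNC: "S \<in> NC n"
      using bij_betw_apply[OF NC_refinements_bij[OF P] F] by (simp add: S_def)
    then have partS: "partition_on {1..n} S" by (simp add: NC_def)
    have FV: "partition_on V (F V)" if "V \<in> P" for V
      using PiE_mem[OF F that] by (simp add: NC_on_def)
    have FS: "W \<in> S" "W \<subseteq> V" "W \<noteq> {}" if "V \<in> P" "W \<in> F V" for V W
      using FV[OF that(1)] that by (auto simp: S_def partition_on_def)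
    have finF: "finite (F V)" if "V \<in> P" for V
      using finite_elements[OF sub(3)[OF that] FV[OF that]] .
    have disj: "F V \<inter> F V' = {}" if "V \<in> P" "V' \<in> P" "V \<noteq> V'" for V V'
    proof (rule ccontr)
      assume "F V \<inter> F V' \<noteq> {}"
      then obtain W where W: "W \<in> F V" "W \<in> F V'" by blast
      then show False
        using FS[OF that(1) W(1)] FS[OF that(2) W(2)] partition_on_block_eq[OF part that(1,2)] that(3)
        by blast
    qed
    have within: "{U. U \<in> S \<and> U \<subseteq> U\<^sub>0} = F U\<^sub>0"
      unfolding S_def by (rule refinement_blocks_within[OF part FV root])
    have "(\<Prod>V\<in>P. h V (F V)) = h U\<^sub>0 (F U\<^sub>0) * (\<Prod>V\<in>P - {U\<^sub>0}. h V (F V))"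
      by (rule prod.remove[OF finP root])
    also have "(\<Prod>V\<in>P - {U\<^sub>0}. h V (F V)) = (\<Prod>V\<in>P - {U\<^sub>0}. \<Prod>W\<in>F V. \<kappa> u\<^sub>0 W)"
      by (intro prod.cong) (auto simp: h_def)
    also have "\<dots> = (\<Prod>W\<in>(\<Union>V\<in>P - {U\<^sub>0}. F V). \<kappa> u\<^sub>0 W)"
      using finP finF disj by (intro prod.UNION_disjoint[symmetric]) auto
    also have "h U\<^sub>0 (F U\<^sub>0) * \<dots> =
      (\<Sum>U\<in>F U\<^sub>0. ?D U * ((\<Prod>W\<in>F U\<^sub>0 - {U}. \<kappa> (Min U) W) * (\<Prod>W\<in>(\<Union>V\<in>P - {U\<^sub>0}. F V). \<kappa> u\<^sub>0 W)))"
      by (simp add: h_def sum_distrib_right mult.assoc)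
    also have "\<dots> = (\<Sum>U\<in>F U\<^sub>0. ?D U * (\<Prod>W\<in>S - {U}. ?C U W))"
    proof (rule sum.cong[OF refl])
      fix U assume U: "U \<in> F U\<^sub>0"
      have "finite U" using FS(2)[OF root U] sub(3)[OF root] finite_subset by blast
      then have minU: "Min U \<in> U" using FS(3)[OF root U] by (rule Min_in)
      have cyc: "?C U W = \<kappa> (Min U) W" if "W \<in> S" "W \<noteq> U" for W
        unfolding \<kappa>_def
        using cyclic_subword_eq_cword[OF SNC FS(1)[OF root U] that(1) that(2)[symmetric] minU] by metis
      \<comment> \<open>Both \<open>Min U\<close> and \<open>u\<^sub>0\<close> lie in
        \<open>U\<^sub>0\<close>, so shrinking the root does not change the words of pieces of the
        other blocks.\<close>
      have "\<kappa> (Min U) W = \<kappa> u\<^sub>0 W" if "V \<in> P - {U\<^sub>0}" "W \<in> F V" for V W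
        unfolding \<kappa>_def using cword_cong[OF P root, of V "Min U" u\<^sub>0 W] that FS[of V W] minU FS(2)[OF root U] u0
        by (metis Diff_iff insertI1 subsetD)
      then have "(\<Prod>W\<in>(\<Union>V\<in>P - {U\<^sub>0}. F V). \<kappa> u\<^sub>0 W) = (\<Prod>W\<in>(\<Union>V\<in>P - {U\<^sub>0}. F V). \<kappa> (Min U) W)"
        by (intro prod.cong[OF refl]) (metis UN_E)
      moreover have "S - {U} = (F U\<^sub>0 - {U}) \<union> (\<Union>V\<in>P - {U\<^sub>0}. F V)"
        using disj[OF root] U root unfolding S_def by blast
      moreover have "(\<Prod>W\<in>(F U\<^sub>0 - {U}) \<union> (\<Union>V\<in>P - {U\<^sub>0}. F V). \<kappa> (Min U) W) =
        (\<Prod>W\<in>F U\<^sub>0 - {U}. \<kappa> (Min U) W) * (\<Prod>W\<in>(\<Union>V\<in>P - {U\<^sub>0}. F V). \<kappa> (Min U) W)"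
        using finF root finP disj[OF root] by (intro prod.union_disjoint) blast+
      moreover have "(\<Prod>W\<in>S - {U}. ?C U W) = (\<Prod>W\<in>S - {U}. \<kappa> (Min U) W)"
        by (intro prod.cong) (auto simp: cyc)
      ultimately show "?D U * ((\<Prod>W\<in>F U\<^sub>0 - {U}. \<kappa> (Min U) W) * (\<Prod>W\<in>(\<Union>V\<in>P - {U\<^sub>0}. F V). \<kappa> u\<^sub>0 W)) =
        ?D U * (\<Prod>W\<in>S - {U}. ?C U W)" by simp
    qed
    finally show "(\<Prod>V\<in>P. h V (F V)) = (\<Sum>U | U \<in> (\<Union>V\<in>P. F V) \<and> U \<subseteq> U\<^sub>0.
      ?D U * (\<Prod>W\<in>(\<Union>V\<in>P. F V) - {U}. ?C U W))"
      unfolding S_def[symmetric] within .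
  qed
  also have "\<dots> = (\<Sum>S | S \<in> NC n \<and> refines {1..n} S P. \<Sum>U | U \<in> S \<and> U \<subseteq> U\<^sub>0.
       ?D U * (\<Prod>W\<in>S - {U}. ?C U W))"
    using sum.reindex_bij_betw[OF NC_refinements_bij[OF P],
      of "\<lambda>S. \<Sum>U | U \<in> S \<and> U \<subseteq> U\<^sub>0. ?D U * (\<Prod>W\<in>S - {U}. ?C U W)"] by simp
  finally show ?thesis .
qed

section \<open>Type B partitions with a zero block as rooted non-crossing partitions\<close>

text \<open>Cutting the signed circle at \<open>\<pm>v\<close> splits it into two halves exchanged by negation;
  \<open>lift_pt v\<close> identifies \<open>{1..n}\<close> with the half \<open>v, \<dots>, n, -1, \<dots>, -(v - 1)\<close>.\<close>

definition lift_pt :: "nat \<Rightarrow> nat \<Rightarrow> int" where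
  "lift_pt v x = (if x < v then - int x else int x)"

text \<open>The half of the signed circle described by \<open>lift_pt v\<close>, recognised by the
  fact that \<open>lift_pt v\<close> recovers its points from their absolute values.\<close>

definition upper :: "nat \<Rightarrow> int \<Rightarrow> bool" where
  "upper v y \<longleftrightarrow> lift_pt v (nat \<bar>y\<bar>) = y"

text \<open>Along this order of the \<open>2 * n\<close> signed points the upper half precedes the
  other one, and negating a point of the upper half adds \<open>n\<close> to its position; see
  \<open>cut_pos_lift\<close>.\<close>

definition cut_pos :: "nat \<Rightarrow> nat \<Rightarrow> int \<Rightarrow> nat" where
  "cut_pos n v y = cpos (2 * n) v (signed_pos n y)"

lemma lift_pt_signed_points: "x \<in> {1..n} \<Longrightarrow> lift_pt v x \<in> signed_points n"
  by (auto simp: lift_pt_def signed_points_def)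

lemma uminus_signed_points: "y \<in> signed_points n \<Longrightarrow> - y \<in> signed_points n"
  by (auto simp: signed_points_def)

lemma uminus_image_signed_points: "uminus ` signed_points n = signed_points n"
proof (intro equalityI subsetI)
  fix y assume "y \<in> signed_points n"
  then have "- y \<in> signed_points n" "y = - (- y)" using uminus_signed_points by auto
  then show "y \<in> uminus ` signed_points n" by (rule rev_image_eqI)
qed (use uminus_signed_points in auto)

lemma abs_signed_points: "y \<in> signed_points n \<Longrightarrow> nat \<bar>y\<bar> \<in> {1..n}"
  by (auto simp: signed_points_def)

lemma not_upper_iff: "y \<in> signed_points n \<Longrightarrow> \<not> upper v y \<longleftrightarrow> lift_pt v (nat \<bar>y\<bar>) = - y"
  by (auto simp: upper_def lift_pt_def signed_points_def)

lemma upper_uminus: "y \<in> signed_points n \<Longrightarrow> upper v (- y) \<longleftrightarrow> \<not> upper v y"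
  by (auto simp: upper_def lift_pt_def signed_points_def)

lemma nat_abs_lift_pt [simp]: "nat \<bar>lift_pt v x\<bar> = x"
  by (simp add: lift_pt_def)

lemma upper_lift_pt: "upper v (lift_pt v x)"
  by (simp add: upper_def)

lemma cut_pos_lift:
  assumes "x \<in> {1..n}" "v \<in> {1..n}"
  shows "cut_pos n v (lift_pt v x) = cpos n v x" "cut_pos n v (- lift_pt v x) = n + cpos n v x"
  using assms by (auto simp: cut_pos_def cpos_def signed_pos_def lift_pt_def nat_add_distrib)

lemma cut_pos_eq:
  assumes "y \<in> signed_points n" "v \<in> {1..n}"
  shows "cut_pos n v y = (if upper v y then cpos n v (nat \<bar>y\<bar>) else n + cpos n v (nat \<bar>y\<bar>))"
  using cut_pos_lift[OF abs_signed_points[OF assms(1)] assms(2)] not_upper_iff[OF assms(1), of v]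
  by (auto simp: upper_def)

lemma cpos_range: "x \<in> {1..n} \<Longrightarrow> v \<in> {1..n} \<Longrightarrow> v \<le> cpos n v x \<and> cpos n v x < n + v"
  by (auto simp: cpos_def)

lemma cpos_self [simp]: "cpos n v v = v"
  by (simp add: cpos_def)

lemma cpos_eq_iff: "x \<in> {1..n} \<Longrightarrow> y \<in> {1..n} \<Longrightarrow> cpos n v x = cpos n v y \<longleftrightarrow> x = y"
  by (auto simp: cpos_def)

lemma signed_pos_inj:
  "x \<in> signed_points n \<Longrightarrow> y \<in> signed_points n \<Longrightarrow> signed_pos n x = signed_pos n y \<Longrightarrow> x = y"
  by (auto simp: signed_points_def signed_pos_def split: if_splits)

lemma noncrossing_cut_pos:
  assumes "\<Union>P \<subseteq> signed_points n" "v \<in> {1..n}"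
  shows "noncrossing (cut_pos n v) P \<longleftrightarrow> noncrossing (signed_pos n) P"
proof
  have rng: "signed_pos n x \<in> {1..2 * n}" if "x \<in> \<Union>P" for x
  proof -
    have "x \<in> signed_points n" using that assms(1) by blast
    then show ?thesis by (auto simp: signed_points_def signed_pos_def)
  qed
  show "noncrossing (signed_pos n) P" if "noncrossing (cut_pos n v) P"
  proof (rule noncrossing_cut[OF that, where low = "\<lambda>x. v \<le> signed_pos n x"])
    fix x y assume "x \<in> \<Union>P" "y \<in> \<Union>P"
    then have xy: "signed_pos n x \<in> {1..2 * n}" "signed_pos n y \<in> {1..2 * n}" using rng by blast+
    show "v \<le> signed_pos n y \<Longrightarrow> \<not> v \<le> signed_pos n x \<Longrightarrow> cut_pos n v y < cut_pos n v x"
      and "signed_pos n x < signed_pos n y \<Longrightarrow>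
        (v \<le> signed_pos n x) = (v \<le> signed_pos n y) \<and> cut_pos n v x < cut_pos n v y \<or>
        \<not> v \<le> signed_pos n x \<and> v \<le> signed_pos n y"
      using xy by (auto simp: cut_pos_def cpos_def)
  qed
  show "noncrossing (cut_pos n v) P" if "noncrossing (signed_pos n) P"
  proof (rule noncrossing_cut[OF that, where low = "\<lambda>x. signed_pos n x < v"])
    fix x y assume "x \<in> \<Union>P" "y \<in> \<Union>P"
    then have xy: "signed_pos n x \<in> {1..2 * n}" "signed_pos n y \<in> {1..2 * n}" using rng by blast+
    show "cut_pos n v x < cut_pos n v y \<Longrightarrow>
      (signed_pos n x < v) = (signed_pos n y < v) \<and> signed_pos n x < signed_pos n y \<or>
      \<not> signed_pos n x < v \<and> signed_pos n y < v"
      using xy assms(2) by (auto simp: cut_pos_def cpos_def split: if_splits)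
  qed auto
qed

section \<open>Zero blocks and the halves that they separate\<close>

lemma NCB_partition: "P \<in> NCB n \<Longrightarrow> partition_on (signed_points n) P"
  by (simp add: NCB_def)

lemma NCB_block_subset: "P \<in> NCB n \<Longrightarrow> W \<in> P \<Longrightarrow> W \<subseteq> signed_points n"
  by (auto simp: NCB_def partition_on_def)

lemma NCB_uminus: "P \<in> NCB n \<Longrightarrow> W \<in> P \<Longrightarrow> uminus ` W \<in> P"
  unfolding NCB_def by blast

lemma NCB_cut: "P \<in> NCB n \<Longrightarrow> v \<in> {1..n} \<Longrightarrow> noncrossing (cut_pos n v) P"
  using noncrossing_cut_pos[of P n v] by (auto simp: NCB_def partition_on_def)

lemma zero_blockD: "zero_block Z \<Longrightarrow> y \<in> Z \<Longrightarrow> - y \<in> Z"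
  unfolding zero_block_def by blast

lemma zero_block_abs:
  assumes Z: "zero_block Z"
  shows "x \<in> abs_block Z \<longleftrightarrow> int x \<in> Z"
proof
  assume "x \<in> abs_block Z"
  then obtain y where y: "y \<in> Z" "x = nat \<bar>y\<bar>" by (auto simp: abs_block_def)
  then have "int x = y \<or> int x = - y" by auto
  then show "int x \<in> Z" using y zero_blockD[OF Z] by auto
qed (force simp: abs_block_def)

text \<open>The points \<open>v\<close> and \<open>- v\<close>, both in \<open>Z\<close>, are those
  at which the two halves begin. A block with points in both halves would cross \<open>Z\<close>
  there.\<close>

lemma zero_block_separates:
  assumes P: "P \<in> NCB n" "Z \<in> P" "zero_block Z" and v: "v \<in> abs_block Z"
    and W: "W \<in> P" "W \<noteq> Z"
  shows "(\<forall>y\<in>W. upper v y) \<or> (\<forall>y\<in>W. \<not> upper v y)"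
proof (rule ccontr)
  assume "\<not> ?thesis"
  then obtain x y where xy: "x \<in> W" "upper v x" "y \<in> W" "\<not> upper v y" by blast
  have vZ: "int v \<in> Z" "- int v \<in> Z" using zero_block_abs[OF P(3)] zero_blockD[OF P(3)] v by auto
  then have vS: "int v \<in> signed_points n" using NCB_block_subset[OF P(1,2)] by blast
  then have v1: "v \<in> {1..n}" by (auto simp: signed_points_def)
  have S: "x \<in> signed_points n" "y \<in> signed_points n" using NCB_block_subset[OF P(1) W(1)] xy by blast+
  have ne: "nat \<bar>x\<bar> \<noteq> v" "nat \<bar>y\<bar> \<noteq> v"
  proof -
    have "x \<notin> Z" "y \<notin> Z" using partition_on_block_eq[OF NCB_partition[OF P(1)] W(1) P(2)] xy W(2) by blast+
    then show "nat \<bar>x\<bar> \<noteq> v" "nat \<bar>y\<bar> \<noteq> v" using vZ by (auto simp: abs_if split: if_splits)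
  qed
  have pv: "cut_pos n v (int v) = v" "cut_pos n v (- int v) = n + v"
    using cut_pos_lift[OF v1 v1] by (simp_all add: lift_pt_def)
  have "v < cpos n v (nat \<bar>x\<bar>)" "cpos n v (nat \<bar>x\<bar>) < n + v" "v < cpos n v (nat \<bar>y\<bar>)"
    using cpos_range[OF abs_signed_points[OF S(1)] v1] cpos_range[OF abs_signed_points[OF S(2)] v1]
      cpos_eq_iff[OF abs_signed_points[OF S(1)] v1, of v] cpos_eq_iff[OF abs_signed_points[OF S(2)] v1, of v]
      ne by auto
  then have "cut_pos n v (int v) < cut_pos n v x" "cut_pos n v x < cut_pos n v (- int v)"
    "cut_pos n v (- int v) < cut_pos n v y"
    using xy by (simp_all add: pv cut_pos_eq[OF S(1) v1] cut_pos_eq[OF S(2) v1])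
  then show False
    using noncrossingD[OF NCB_cut[OF P(1) v1] P(2) W(1) W(2)[symmetric] vZ(1) xy(1) vZ(2) xy(3)] by blast
qed

text \<open>A second zero block would contain some \<open>y\<close> together with
  \<open>- y\<close>, and these lie in different halves for every cut at a point of the first
  one.\<close>

lemma zero_block_unique:
  assumes P: "P \<in> NCB n" "Z \<in> P" "zero_block Z" "Z' \<in> P" "zero_block Z'"
  shows "Z' = Z"
proof (rule ccontr)
  assume ne: "Z' \<noteq> Z"
  have "Z \<noteq> {}" "Z' \<noteq> {}" using NCB_partition[OF P(1)] P by (auto simp: partition_on_def)
  then obtain x y where xy: "x \<in> Z" "y \<in> Z'" by blast
  then have "nat \<bar>x\<bar> \<in> abs_block Z" by (auto simp: abs_block_def)
  then have "upper v y \<longleftrightarrow> upper v (- y)" if "v = nat \<bar>x\<bar>" for v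
    using zero_block_separates[OF P(1,2,3) _ P(4) ne] zero_blockD[OF P(5) xy(2)] xy that by blast
  moreover have "y \<in> signed_points n" using NCB_block_subset[OF P(1,4)] xy by blast
  ultimately show False using upper_uminus by blast
qed

lemma zero_image_eq: "P \<in> NCB n \<Longrightarrow> Z \<in> P \<Longrightarrow> zero_block Z \<Longrightarrow> zero_image P = abs_block Z"
  unfolding zero_image_def using zero_block_unique by (subst the_equality[of _ Z]) blast+

lemma NCZ_E:
  assumes "P \<in> NCZ n"
  obtains Z where "P \<in> NCB n" "Z \<in> P" "zero_block Z" "zero_image P = abs_block Z"
  using assms zero_image_eq unfolding NCZ_def by blast

lemma abs_block_uminus [simp]: "abs_block (uminus ` W) = abs_block W"
  by (simp add: abs_block_def image_image)

lemma lift_abs_upper: "\<forall>y\<in>W. upper v y \<Longrightarrow> lift_pt v ` abs_block W = W"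
  by (force simp: abs_block_def upper_def)

lemma abs_lift [simp]: "abs_block (lift_pt v ` V) = V"
  by (force simp: abs_block_def image_image)

lemma lift_abs_not_upper:
  assumes "\<forall>y\<in>W. \<not> upper v y" "W \<subseteq> signed_points n"
  shows "lift_pt v ` abs_block W = uminus ` W"
proof -
  have "lift_pt v (nat \<bar>y\<bar>) = - y" if "y \<in> W" for y
    using that assms not_upper_iff by blast
  then show ?thesis unfolding abs_block_def image_image by (intro image_cong) auto
qed

text \<open>By \<open>double_abs\<close> this is the only zero block whose image under absolute
  value is \<open>U\<close>.\<close>

definition double :: "nat set \<Rightarrow> int set" where
  "double U = int ` U \<union> uminus ` int ` U"

lemma double_abs: "zero_block Z \<Longrightarrow> double (abs_block Z) = Z"
  unfolding double_def by (auto simp: zero_block_abs zero_blockD) (force simp: abs_block_def image_iff)+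

lemma abs_double: "abs_block (double U) = U"
  by (force simp: abs_block_def double_def)

lemma zero_block_double: "zero_block (double U)"
  by (force simp: zero_block_def double_def)

lemma lift_subset_double: "lift_pt v ` U \<subseteq> double U"
  by (auto simp: lift_pt_def double_def)

text \<open>The inverse of \<open>P \<mapsto> (abs_partition P, zero_image P)\<close>: the root
  becomes the zero block, and every other block gets one copy in each half. The point
  \<open>v\<close> serves to name the halves; it is to be taken in \<open>U\<close>, so that both
  halves begin at points of the zero block.\<close>

definition lift_partition :: "nat \<Rightarrow> nat set set \<Rightarrow> nat set \<Rightarrow> int set set" where
  "lift_partition v S U =
     insert (double U) (\<Union>V\<in>S - {U}. {lift_pt v ` V, uminus ` lift_pt v ` V})"

locale type_B_zero =
  fixes n :: nat and P :: "int set set" and Z :: "int set" and v :: nat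
  assumes P: "P \<in> NCB n" and Z: "Z \<in> P" "zero_block Z" and v: "v \<in> abs_block Z"
begin

lemma zero_image: "zero_image P = abs_block Z"
  by (rule zero_image_eq[OF P Z])

lemma v_range: "v \<in> {1..n}"
  using zero_block_abs[OF Z(2)] v NCB_block_subset[OF P Z(1)] by (force simp: signed_points_def)

lemma lift_block:
  assumes W: "W \<in> P" "W \<noteq> Z"
  shows "lift_pt v ` abs_block W = W \<or> lift_pt v ` abs_block W = uminus ` W"
  using zero_block_separates[OF P Z v W]
proof
  assume "\<forall>y\<in>W. upper v y"
  then show ?thesis by (intro disjI1 lift_abs_upper)
next
  assume "\<forall>y\<in>W. \<not> upper v y"
  then show ?thesis by (intro disjI2 lift_abs_not_upper[OF _ NCB_block_subset[OF P W(1)]])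
qed

lemma abs_block_eq:
  assumes "W \<in> P" "W' \<in> P" "x \<in> abs_block W" "x \<in> abs_block W'"
  shows "W' = W \<or> W' = uminus ` W"
proof -
  obtain y y' where y: "y \<in> W" "y' \<in> W'" "x = nat \<bar>y\<bar>" "x = nat \<bar>y'\<bar>"
    using assms by (auto simp: abs_block_def)
  then have "y' = y \<or> y' = - y" by linarith
  then show ?thesis
    using y assms partition_on_block_eq[OF NCB_partition[OF P]] NCB_uminus[OF P assms(1)] by blast
qed

lemma abs_zero_iff: "W \<in> P \<Longrightarrow> abs_block W = abs_block Z \<longleftrightarrow> W = Z"
  using abs_block_eq[of Z W v] Z v unfolding zero_block_def by auto

text \<open>Blocks of the image are carried back into \<open>P\<close>, the root to \<open>Z\<close>
  and every other block to its copy in the upper half. This is increasing along the cut at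
  \<open>v\<close>, so a crossing of the image would give one in \<open>P\<close>.\<close>

lemma abs_in_NC: "abs_partition P \<in> NC n"
proof -
  have "partition_on {1..n} (abs_partition P)"
  proof (rule partition_onI)
    have "\<Union>(abs_partition P) = abs_block (\<Union>P)" by (auto simp: abs_partition_def abs_block_def)
    also have "\<Union>P = signed_points n" using NCB_partition[OF P] by (simp add: partition_on_def)
    also have "abs_block (signed_points n) = {1..n}"
    proof (intro equalityI subsetI)
      fix x assume "x \<in> {1..n}"
      then have "int x \<in> signed_points n" "x = nat \<bar>int x\<bar>" by (auto simp: signed_points_def)
      then show "x \<in> abs_block (signed_points n)" unfolding abs_block_def by (rule rev_image_eqI)
    qed (auto simp: abs_block_def signed_points_def)
    finally show "\<Union>(abs_partition P) = {1..n}" .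
    show "{} \<notin> abs_partition P"
      using NCB_partition[OF P] by (auto simp: abs_partition_def abs_block_def partition_on_def)
    fix p q assume "p \<in> abs_partition P" "q \<in> abs_partition P" "p \<noteq> q"
    then obtain W W' where W: "W \<in> P" "p = abs_block W" "W' \<in> P" "q = abs_block W'"
      by (auto simp: abs_partition_def)
    have "x \<notin> q" if "x \<in> p" for x
      using abs_block_eq[OF W(1,3), of x] that W(2,4) \<open>p \<noteq> q\<close> by auto
    then show "disjnt p q" by (auto simp: disjnt_iff)
  qed
  moreover have "noncrossing (cpos n v) (abs_partition P)"
  proof (rule noncrossing_transfer[OF NCB_cut[OF P v_range],
      where h = "\<lambda>V. if V = abs_block Z then Z else lift_pt v ` V" and f = "lift_pt v"])
    show "(if V = abs_block Z then Z else lift_pt v ` V) \<in> P" if V: "V \<in> abs_partition P" for V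
    proof -
      obtain W where W: "W \<in> P" "V = abs_block W" using V unfolding abs_partition_def by blast
      show ?thesis
      proof (cases "W = Z")
        case False
        then show ?thesis
          using lift_block[OF W(1) False] NCB_uminus[OF P W(1)] W abs_zero_iff[OF W(1)] by auto
      qed (use W Z in auto)
    qed
    show "lift_pt v x \<in> (if V = abs_block Z then Z else lift_pt v ` V)"
      if "V \<in> abs_partition P" "x \<in> V" for V x
      using that lift_subset_double[of v "abs_block Z"] double_abs[OF Z(2)] by auto
    show "inj_on (\<lambda>V. if V = abs_block Z then Z else lift_pt v ` V) (abs_partition P)"
      by (rule inj_on_inverseI[where g = abs_block]) simp
    fix V W x y assume "V \<in> abs_partition P" "W \<in> abs_partition P" "x \<in> V" "y \<in> W" and l: "cpos n v x < cpos n v y"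
    then have "x \<in> {1..n}" "y \<in> {1..n}" using \<open>partition_on {1..n} (abs_partition P)\<close> by (auto simp: partition_on_def)
    then show "cut_pos n v (lift_pt v x) < cut_pos n v (lift_pt v y)"
      using l v_range by (simp add: cut_pos_lift)
  qed
  ultimately show ?thesis
    using noncrossing_cpos[of "abs_partition P" n v] v_range by (auto simp: NC_def partition_on_def)
qed

lemma zero_image_in_abs: "zero_image P \<in> abs_partition P"
  using zero_image Z by (simp add: abs_partition_def)

lemma eq_lift_partition: "P = lift_partition v (abs_partition P) (zero_image P)"
proof (intro equalityI subsetI)
  fix W assume W: "W \<in> P"
  show "W \<in> lift_partition v (abs_partition P) (zero_image P)"
  proof (cases "W = Z")
    case True
    then show ?thesis using double_abs[OF Z(2)] by (simp add: lift_partition_def zero_image)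
  next
    case False
    have "uminus ` uminus ` W = W" by (simp add: image_image)
    then have "lift_pt v ` abs_block W = W \<or> uminus ` lift_pt v ` abs_block W = W"
      using lift_block[OF W False] by metis
    moreover have "abs_block W \<in> abs_partition P - {zero_image P}"
      using W False abs_zero_iff[OF W] by (simp add: abs_partition_def zero_image)
    ultimately show ?thesis
      unfolding lift_partition_def by (metis (no_types, lifting) UN_I insertCI)
  qed
next
  fix W assume "W \<in> lift_partition v (abs_partition P) (zero_image P)"
  then consider "W = Z" | W' where "W' \<in> P" "abs_block W' \<noteq> abs_block Z"
      "W = lift_pt v ` abs_block W' \<or> W = uminus ` lift_pt v ` abs_block W'"
    unfolding lift_partition_def zero_image double_abs[OF Z(2)] abs_partition_def by blast
  then show "W \<in> P"
  proof cases
    case (2 W')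
    then have "lift_pt v ` abs_block W' \<in> P"
      using lift_block[OF 2(1)] NCB_uminus[OF P 2(1)] 2(1,2) by metis
    then show ?thesis using 2(3) NCB_uminus[OF P] by blast
  qed (use Z in simp)
qed

end

text \<open>The point is that lifting creates no crossing. Along the cut at \<open>v\<close> a block
  other than the zero block stays in one half, so every point between two of its points lies in that
  half as well. Within one half, absolute value maps a crossing of the lift to a crossing of
  \<open>S\<close>.\<close>

lemma lift_partition_NCZ:
  assumes S: "S \<in> NC n" and U: "U \<in> S" and v: "v \<in> U"
  shows "lift_partition v S U \<in> NCZ n" "abs_partition (lift_partition v S U) = S"
    "zero_image (lift_partition v S U) = U"
proof -
  let ?P = "lift_partition v S U"
  have part: "partition_on {1..n} S" and nc: "noncrossing (\<lambda>i. i) S" using S by (auto simp: NC_def)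
  have sub: "V \<subseteq> {1..n}" if "V \<in> S" for V using that part by (auto simp: partition_on_def)
  have v1: "v \<in> {1..n}" using sub U v by blast
  have blocks: "W \<in> ?P \<Longrightarrow> W = double U \<or> (\<exists>V\<in>S - {U}. W = lift_pt v ` V \<or> W = uminus ` lift_pt v ` V)" for W
    by (auto simp: lift_partition_def)
  have abs_blocks: "abs_block W \<in> S" "abs_block W = U \<longleftrightarrow> W = double U" if "W \<in> ?P" for W
    using blocks[OF that] U by (auto simp: abs_double)
  \<comment> \<open>A common point forces equal images under absolute value, so only the two copies
    of one block could meet, and these lie in opposite halves.\<close>
  have same: "W = W' \<or> W \<inter> W' = {}" if W: "W \<in> ?P" "W' \<in> ?P" for W W'
  proof (rule ccontr)
    assume "\<not> ?thesis"
    then obtain y where y: "W \<noteq> W'" "y \<in> W" "y \<in> W'" by blast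
    then have "nat \<bar>y\<bar> \<in> abs_block W" "nat \<bar>y\<bar> \<in> abs_block W'" by (auto simp: abs_block_def)
    then have eq: "abs_block W = abs_block W'"
      using partition_on_block_eq[OF part] abs_blocks W by blast
    then have ne: "W \<noteq> double U" "W' \<noteq> double U" using abs_blocks W y(1) by metis+
    then obtain V V' where V: "V \<in> S - {U}" "W = lift_pt v ` V \<or> W = uminus ` lift_pt v ` V"
      "V' \<in> S - {U}" "W' = lift_pt v ` V' \<or> W' = uminus ` lift_pt v ` V'"
      using blocks[OF W(1)] blocks[OF W(2)] by blast
    then have "V = V'" using eq by auto
    then have "y \<in> lift_pt v ` V \<and> y \<in> uminus ` lift_pt v ` V"
      using V(2,4) y by metis
    then obtain x x' where x: "x \<in> V" "x' \<in> V" "lift_pt v x = - lift_pt v x'"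
      by blast
    then have "x' \<in> {1..n}" using sub V(1) by blast
    then show False using upper_lift_pt[of v x] upper_lift_pt[of v x'] x(3)
        upper_uminus[OF lift_pt_signed_points[of x' n v], of v] by simp
  qed
  have union: "\<Union>?P = signed_points n"
  proof (intro equalityI subsetI)
    fix y assume "y \<in> \<Union>?P"
    then obtain W where W: "W \<in> ?P" "y \<in> W" by blast
    then have "nat \<bar>y\<bar> \<in> abs_block W" by (auto simp: abs_block_def)
    then have "nat \<bar>y\<bar> \<in> {1..n}" using sub[OF abs_blocks(1)[OF W(1)]] by blast
    then show "y \<in> signed_points n" by (auto simp: signed_points_def)
  next
    fix y assume y: "y \<in> signed_points n"
    obtain V where V: "V \<in> S" "nat \<bar>y\<bar> \<in> V"
      by (rule partition_on_obtains[OF part abs_signed_points[OF y]])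
    show "y \<in> \<Union>?P"
    proof (cases "V = U")
      case True
      have "y = int (nat \<bar>y\<bar>) \<or> y = - int (nat \<bar>y\<bar>)" by linarith
      then have "y \<in> double U" using V True unfolding double_def by blast
      then show ?thesis by (auto simp: lift_partition_def)
    next
      case False
      have "y = lift_pt v (nat \<bar>y\<bar>) \<or> y = - lift_pt v (nat \<bar>y\<bar>)"
        using not_upper_iff[OF y, of v] by (auto simp: upper_def)
      then have "y \<in> lift_pt v ` V \<or> y \<in> uminus ` lift_pt v ` V" using V by blast
      then show ?thesis using V False by (auto simp: lift_partition_def)
    qed
  qed
  have partP: "partition_on (signed_points n) ?P"
  proof (rule partition_onI[OF union])
    show "disjnt p q" if "p \<in> ?P" "q \<in> ?P" "p \<noteq> q" for p q
      using same[OF that(1,2)] that(3) by (simp add: disjnt_def)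
    show "{} \<notin> ?P"
    proof
      assume "{} \<in> ?P"
      then have "{} \<in> S" using abs_blocks(1) by (force simp: abs_block_def)
      then show False using part by (simp add: partition_on_def)
    qed
  qed
  have ncS: "noncrossing (cpos n v) S"
    using noncrossing_cpos[of S n v] nc part v1 by (simp add: partition_on_def)
  have half: "(\<forall>y\<in>W. upper v y) \<or> (\<forall>y\<in>W. \<not> upper v y)" if W: "W \<in> ?P" "W \<noteq> double U" for W
  proof -
    obtain V where V: "V \<in> S" "W = lift_pt v ` V \<or> W = uminus ` lift_pt v ` V" using blocks[OF W(1)] W(2) by blast
    have "\<not> upper v (- lift_pt v x)" if "x \<in> V" for x
      using upper_uminus[OF lift_pt_signed_points[of x n v], of v] upper_lift_pt[of v x] that sub[OF V(1)] by blast
    then show ?thesis using V(2) upper_lift_pt by auto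
  qed
  have "noncrossing (cut_pos n v) ?P"
    unfolding noncrossing_def
  proof (intro ballI impI notI)
    fix A B assume AB: "A \<in> ?P" "B \<in> ?P" "A \<noteq> B"
      and "\<exists>a\<in>A. \<exists>b\<in>B. \<exists>c\<in>A. \<exists>d\<in>B. cut_pos n v a < cut_pos n v b \<and> cut_pos n v b < cut_pos n v c \<and> cut_pos n v c < cut_pos n v d"
    then obtain a b c d where m: "a \<in> A" "b \<in> B" "c \<in> A" "d \<in> B"
      and less: "cut_pos n v a < cut_pos n v b" "cut_pos n v b < cut_pos n v c" "cut_pos n v c < cut_pos n v d"
      by blast
    have pts: "a \<in> signed_points n" "b \<in> signed_points n" "c \<in> signed_points n" "d \<in> signed_points n"
      using m AB union by blast+
    define q where "q y = cpos n v (nat \<bar>y\<bar>)" for y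
    have rng: "v \<le> q y \<and> q y < n + v" if "y \<in> signed_points n" for y
      unfolding q_def by (rule cpos_range[OF abs_signed_points[OF that] v1])
    have cp: "cut_pos n v y = (if upper v y then q y else n + q y)" if "y \<in> signed_points n" for y
      unfolding q_def by (rule cut_pos_eq[OF that v1])
    have q_v: "q y = v \<Longrightarrow> nat \<bar>y\<bar> = v" if "y \<in> signed_points n" for y
      unfolding q_def using cpos_eq_iff[OF abs_signed_points[OF that] v1, of v] by simp
    have abs_in: "nat \<bar>y\<bar> \<in> abs_block C" if "y \<in> C" for y C using that by (auto simp: abs_block_def)
    have vU: "v \<in> abs_block C \<Longrightarrow> C = double U" if "C \<in> ?P" for C
      using abs_blocks[OF that] partition_on_block_eq[OF part _ U _ v] by blast
    note pc = cp[OF pts(1)] cp[OF pts(2)] cp[OF pts(3)] cp[OF pts(4)]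
    note pr = rng[OF pts(1)] rng[OF pts(2)] rng[OF pts(3)] rng[OF pts(4)]
    have crossS: "\<not> (q x1 < q x2 \<and> q x2 < q x3 \<and> q x3 < q x4)"
      if "x1 \<in> C" "x2 \<in> D" "x3 \<in> C" "x4 \<in> D" "C \<in> ?P" "D \<in> ?P" "abs_block C \<noteq> abs_block D" for x1 x2 x3 x4 C D
      unfolding q_def
      using noncrossingD[OF ncS abs_blocks(1)[OF that(5)] abs_blocks(1)[OF that(6)] that(7)
          abs_in[OF that(1)] abs_in[OF that(2)] abs_in[OF that(3)] abs_in[OF that(4)]] .
    have mono: "q x < q y" if "cut_pos n v x < cut_pos n v y" "upper v x \<longleftrightarrow> upper v y"
      "x \<in> signed_points n" "y \<in> signed_points n" for x y
      using that(1,2) cp[OF that(3)] cp[OF that(4)] by (auto split: if_splits)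
    have up: "upper v x" if "cut_pos n v x < cut_pos n v y" "upper v y"
      "x \<in> signed_points n" "y \<in> signed_points n" for x y
      using that(1,2) cp[OF that(3)] cp[OF that(4)] rng[OF that(3)] rng[OF that(4)] by (auto split: if_splits)
    \<comment> \<open>\<open>v\<close> has the least value of \<open>q\<close>. In a crossing with
      the zero block it replaces the outer point of that block, which may lie in the other
      half.\<close>
    have vD: "int v \<in> double U" using v by (auto simp: double_def)
    have q_v': "q (int v) = v" by (simp add: q_def)
    have gt: "v < q y" if "y \<in> C" "C \<in> ?P" "C \<noteq> double U" "y \<in> signed_points n" for y C
      using q_v[OF that(4)] rng[OF that(4)] vU[OF that(2)] that(3) abs_in[OF that(1)] by (metis le_neq_implies_less)
    show False
    proof (cases "B = double U")
      case True
      then have A: "A \<noteq> double U" using AB by simp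
      then have "upper v a \<longleftrightarrow> upper v c" using half[OF AB(1) A] m by blast
      then have u: "upper v a \<longleftrightarrow> upper v b" "upper v b \<longleftrightarrow> upper v c"
        using up[OF less(1) _ pts(1,2)] up[OF less(2) _ pts(2,3)] by blast+
      have "v < q a" by (rule gt[OF m(1) AB(1) A pts(1)])
      moreover have "q a < q b" "q b < q c" using mono less u pts by blast+
      ultimately show False
        using crossS[OF vD m(1) m(2)[unfolded True] m(3)] AB True A abs_blocks q_v' by metis
    next
      case B: False
      then have ud: "upper v b \<longleftrightarrow> upper v d" using half[OF AB(2) B] m by blast
      then have u: "upper v b \<longleftrightarrow> upper v c" "upper v c \<longleftrightarrow> upper v d"
        using up[OF less(2) _ pts(2,3)] up[OF less(3) _ pts(3,4)] by blast+
      have q: "q b < q c" "q c < q d" using mono less u pts by blast+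
      show False
      proof (cases "A = double U")
        case True
        have "v < q b" by (rule gt[OF m(2) AB(2) B pts(2)])
        then show False
          using crossS[OF vD m(2) m(3)[unfolded True] m(4)] AB True B q abs_blocks q_v' by metis
      next
        case A: False
        then have "upper v a \<longleftrightarrow> upper v c" using half[OF AB(1) A] m by blast
        then have ab: "upper v a \<longleftrightarrow> upper v b" using u by blast
        then have qa: "q a < q b" using mono less pts by blast
        \<comment> \<open>Two blocks in the same half with the same image would be equal.\<close>
        have "abs_block A \<noteq> abs_block B"
        proof
          assume eq: "abs_block A = abs_block B"
          have "A = B"
          proof (cases "upper v a")
            case True
            then have "\<forall>y\<in>A. upper v y" "\<forall>y\<in>B. upper v y"
              using half[OF AB(1) A] half[OF AB(2) B] m ab by blast+
            then show ?thesis using lift_abs_upper eq by metis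
          next
            case False
            then have "\<forall>y\<in>A. \<not> upper v y" "\<forall>y\<in>B. \<not> upper v y"
              using half[OF AB(1) A] half[OF AB(2) B] m ab by blast+
            then have "uminus ` A = uminus ` B"
              using lift_abs_not_upper[of A v n] lift_abs_not_upper[of B v n] eq AB union
              by (metis Union_upper)
            then show ?thesis by (simp add: inj_image_eq_iff)
          qed
          then show False using AB by simp
        qed
        then show False using crossS[OF m AB(1,2)] qa q by blast
      qed
    qed
  qed
  then have ncP: "noncrossing (signed_pos n) ?P"
    using noncrossing_cut_pos[of ?P n v] v1 union by simp
  have uu: "uminus ` uminus ` W = W" for W :: "int set" by (simp add: image_image)
  have in_P: "lift_pt v ` V \<in> ?P" "uminus ` lift_pt v ` V \<in> ?P" if "V \<in> S - {U}" for V
    using that unfolding lift_partition_def by blast+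
  have D: "double U \<in> ?P" by (simp add: lift_partition_def)
  have "uminus ` W \<in> ?P" if "W \<in> ?P" for W
    using blocks[OF that] in_P D uu zero_block_double[of U] unfolding zero_block_def by metis
  then have "(`) uminus ` ?P = ?P"
    using uu by (metis (no_types, lifting) image_eqI image_subsetI subsetI subset_antisym)
  then have NCB: "?P \<in> NCB n" using partP ncP by (simp add: NCB_def)
  then show "?P \<in> NCZ n"
    unfolding NCZ_def mem_Collect_eq by (intro conjI NCB bexI[of _ "double U"] zero_block_double D)
  show "zero_image ?P = U" using zero_image_eq[OF NCB D zero_block_double] by (simp add: abs_double)
  have "V \<in> abs_block ` ?P" if "V \<in> S" for V
  proof (cases "V = U")
    case True
    then show ?thesis using D abs_double by (metis image_eqI)
  next
    case False
    then have "lift_pt v ` V \<in> ?P" using that in_P by blast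
    then show ?thesis using abs_lift by (metis image_eqI)
  qed
  then show "abs_partition ?P = S" using abs_blocks(1) by (auto simp: abs_partition_def)
qed

section \<open>Refinement in terms of images and roots\<close>

lemma NCZ_zero_image_point:
  assumes "P \<in> NCZ n"
  obtains Z v where "type_B_zero n P Z v"
proof -
  obtain Z where Z: "P \<in> NCB n" "Z \<in> P" "zero_block Z" using assms by (auto simp: NCZ_def)
  then have "Z \<noteq> {}" using NCB_partition[OF Z(1)] by (auto simp: partition_on_def)
  then obtain v where "v \<in> abs_block Z" by (auto simp: abs_block_def)
  then show ?thesis using that Z by (simp add: type_B_zero_def)
qed

lemma NCZ_abs_partition: "P \<in> NCZ n \<Longrightarrow> abs_partition P \<in> NC n"
  using NCZ_zero_image_point type_B_zero.abs_in_NC by metis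

lemma NCZ_zero_image: "P \<in> NCZ n \<Longrightarrow> zero_image P \<in> abs_partition P"
  using NCZ_zero_image_point type_B_zero.zero_image_in_abs by metis

lemma NCZ_eq_lift_partition:
  assumes "P \<in> NCZ n" "v \<in> zero_image P"
  shows "P = lift_partition v (abs_partition P) (zero_image P)"
proof -
  obtain Z where "P \<in> NCB n" "Z \<in> P" "zero_block Z" "zero_image P = abs_block Z"
    using NCZ_E[OF assms(1)] by blast
  then show ?thesis
    using assms(2) by (intro type_B_zero.eq_lift_partition[of n P Z v]) (simp add: type_B_zero_def)
qed

lemma NCZ_zero_image_nonempty:
  assumes "P \<in> NCZ n" shows "zero_image P \<noteq> {}"
  using NCZ_zero_image[OF assms] NCZ_abs_partition[OF assms] by (auto simp: NC_def partition_on_def)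

text \<open>The block of \<open>Q\<close> around \<open>Z\<close> and its negative share the points
  of \<open>Z\<close>, so they coincide.\<close>

lemma refines_zero_block:
  assumes P: "P \<in> NCB n" and Q: "partition_on (signed_points n) Q" "(`) uminus ` Q = Q"
    and ref: "refines (signed_points n) P Q" and Z: "Z \<in> P" "zero_block Z"
  obtains Z' where "Z' \<in> Q" "zero_block Z'" "Z \<subseteq> Z'"
proof -
  obtain Z' where Z': "Z' \<in> Q" "Z \<subseteq> Z'" using ref Z(1) by (auto simp: refines_def)
  have "Z \<noteq> {}" using NCB_partition[OF P] Z by (auto simp: partition_on_def)
  then obtain y where y: "y \<in> Z" by blast
  have "uminus ` Z' \<in> Q" using Q(2) Z'(1) by blast
  moreover have "y \<in> uminus ` Z'" using zero_blockD[OF Z(2) y] Z'(2) by (force simp: image_iff)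
  ultimately have "uminus ` Z' = Z'"
    using partition_on_block_eq[OF Q(1)] Z' y by blast
  then show ?thesis using that Z' by (simp add: zero_block_def)
qed

text \<open>This keeps the join of some \<open>\<sigma>\<close> in \<open>NCZ p\<close> with the
  interval partition inside \<open>NCZ p\<close>.\<close>

lemma refines_NCZ:
  assumes "P \<in> NCZ n" "Q \<in> NCB n" "refines (signed_points n) P Q"
  shows "Q \<in> NCZ n"
proof -
  obtain Z where Z: "P \<in> NCB n" "Z \<in> P" "zero_block Z" using assms(1) by (auto simp: NCZ_def)
  have "(`) uminus ` Q = Q" using assms(2) by (simp add: NCB_def)
  then obtain Z' where "Z' \<in> Q" "zero_block Z'"
    by (rule refines_zero_block[OF Z(1) NCB_partition[OF assms(2)] _ assms(3) Z(2,3)])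
  then show ?thesis using assms(2) unfolding NCZ_def by blast
qed

text \<open>For the converse, both partitions are lifted from one point \<open>v\<close> of the
  smaller root, which then lies in both roots. With common halves, inclusions of blocks lift copy by
  copy, and a block inside the larger root goes into the zero block.\<close>

lemma NCZ_refines_iff:
  assumes P: "P \<in> NCZ n" and Q: "Q \<in> NCZ n"
  shows "refines (signed_points n) P Q \<longleftrightarrow>
    refines {1..n} (abs_partition P) (abs_partition Q) \<and> zero_image P \<subseteq> zero_image Q"
proof -
  obtain Z where Z: "P \<in> NCB n" "Z \<in> P" "zero_block Z" "zero_image P = abs_block Z"
    by (rule NCZ_E[OF P])
  obtain Y where Y: "Q \<in> NCB n" "Y \<in> Q" "zero_block Y" "zero_image Q = abs_block Y"
    by (rule NCZ_E[OF Q])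
  have parts: "partition_on {1..n} (abs_partition P)" "partition_on {1..n} (abs_partition Q)"
    using NCZ_abs_partition P Q by (auto simp: NC_def)
  show ?thesis
  proof
    assume ref: "refines (signed_points n) P Q"
    have "\<exists>W\<in>abs_partition Q. V \<subseteq> W" if V: "V \<in> abs_partition P" for V
    proof -
      obtain V' where V': "V' \<in> P" "V = abs_block V'" using V unfolding abs_partition_def by blast
      then obtain W where W: "W \<in> Q" "V' \<subseteq> W" using ref by (auto simp: refines_def)
      then show ?thesis using V' by (auto simp: abs_partition_def abs_block_def)
    qed
    then have "refines {1..n} (abs_partition P) (abs_partition Q)"
      using parts by (auto simp: refines_def)
    moreover have "zero_image P \<subseteq> zero_image Q"
    proof -
      have "(`) uminus ` Q = Q" using Y(1) by (simp add: NCB_def)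
      then obtain Z' where "Z' \<in> Q" "zero_block Z'" "Z \<subseteq> Z'"
        using refines_zero_block[OF Z(1) NCB_partition[OF Y(1)] _ ref Z(2,3)] by blast
      then show ?thesis using zero_block_unique[OF Y(1,2,3)] Z(4) Y(4) by (auto simp: abs_block_def)
    qed
    ultimately show "refines {1..n} (abs_partition P) (abs_partition Q) \<and> zero_image P \<subseteq> zero_image Q" ..
  next
    assume ref: "refines {1..n} (abs_partition P) (abs_partition Q) \<and> zero_image P \<subseteq> zero_image Q"
    obtain v where v: "v \<in> zero_image P" using NCZ_zero_image_nonempty[OF P] by blast
    then have v': "v \<in> zero_image Q" using ref by blast
    note eqP = NCZ_eq_lift_partition[OF P v] and eqQ = NCZ_eq_lift_partition[OF Q v']
    have "\<exists>B\<in>lift_partition v (abs_partition Q) (zero_image Q). A \<subseteq> B"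
      if "A \<in> lift_partition v (abs_partition P) (zero_image P)" for A
    proof -
      have D: "double (zero_image P) \<subseteq> double (zero_image Q)"
        using ref by (auto simp: double_def)
      have DQ: "double (zero_image Q) \<in> lift_partition v (abs_partition Q) (zero_image Q)"
        by (simp add: lift_partition_def)
      consider "A = double (zero_image P)" | V where "V \<in> abs_partition P"
        "A = lift_pt v ` V \<or> A = uminus ` lift_pt v ` V"
        using \<open>A \<in> _\<close> unfolding lift_partition_def by blast
      then show ?thesis
      proof cases
        case (2 V)
        then obtain W where W: "W \<in> abs_partition Q" "V \<subseteq> W" using ref by (auto simp: refines_def)
        show ?thesis
        proof (cases "W = zero_image Q")
          case True
          have "lift_pt v ` V \<subseteq> double (zero_image Q)"
            using lift_subset_double[of v "zero_image Q"] W True by blast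
          moreover from this have "uminus ` lift_pt v ` V \<subseteq> double (zero_image Q)"
            using zero_block_double[of "zero_image Q"] unfolding zero_block_def by blast
          ultimately show ?thesis using 2 DQ by blast
        next
          case False
          then have "lift_pt v ` W \<in> lift_partition v (abs_partition Q) (zero_image Q)"
            "uminus ` lift_pt v ` W \<in> lift_partition v (abs_partition Q) (zero_image Q)"
            using W unfolding lift_partition_def by blast+
          moreover have "lift_pt v ` V \<subseteq> lift_pt v ` W" "uminus ` lift_pt v ` V \<subseteq> uminus ` lift_pt v ` W"
            using W by blast+
          ultimately show ?thesis using 2(2) by blast
        qed
      qed (use D DQ in blast)
    qed
    then show "refines (signed_points n) P Q"
      unfolding refines_def using NCB_partition Z(1) Y(1) eqP eqQ by metis
  qed
qed

lemma NCZ_rooted_bij: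
  assumes Q: "Q \<in> NCZ n"
  shows "bij_betw (\<lambda>P. (abs_partition P, zero_image P))
    {P \<in> NCZ n. refines (signed_points n) P Q}
    (SIGMA S:{S \<in> NC n. refines {1..n} S (abs_partition Q)}. {U \<in> S. U \<subseteq> zero_image Q})"
    (is "bij_betw _ ?A ?B")
proof (rule bij_betw_imageI)
  show "inj_on (\<lambda>P. (abs_partition P, zero_image P)) ?A"
  proof (rule inj_onI)
    fix P P' assume P: "P \<in> ?A" "P' \<in> ?A"
      and eq: "(abs_partition P, zero_image P) = (abs_partition P', zero_image P')"
    obtain v where "v \<in> zero_image P" using NCZ_zero_image_nonempty P(1) by blast
    then show "P = P'" using NCZ_eq_lift_partition[of P n v] NCZ_eq_lift_partition[of P' n v] P eq by simp
  qed
  show "(\<lambda>P. (abs_partition P, zero_image P)) ` ?A = ?B"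
  proof (intro equalityI subsetI)
    fix x assume "x \<in> (\<lambda>P. (abs_partition P, zero_image P)) ` ?A"
    then show "x \<in> ?B"
      using NCZ_refines_iff[OF _ Q] NCZ_abs_partition NCZ_zero_image by auto
  next
    fix x assume "x \<in> ?B"
    then obtain S U where x: "x = (S, U)" "S \<in> NC n" "refines {1..n} S (abs_partition Q)" "U \<in> S" "U \<subseteq> zero_image Q"
      by auto
    have "U \<noteq> {}" using x by (auto simp: NC_def partition_on_def)
    then obtain v where v: "v \<in> U" by blast
    note L = lift_partition_NCZ[OF x(2,4) v]
    have "lift_partition v S U \<in> ?A" using L NCZ_refines_iff[OF L(1) Q] x by simp
    then show "x \<in> (\<lambda>P. (abs_partition P, zero_image P)) ` ?A"
      by (rule rev_image_eqI) (simp add: L x(1))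
  qed
qed

lemma finite_NCB: "finite (NCB n)"
proof (rule finite_subset)
  show "NCB n \<subseteq> Pow (Pow (signed_points n))" by (auto simp: NCB_def partition_on_def)
  have "signed_points n \<subseteq> {- int n..int n}" by (auto simp: signed_points_def)
  then show "finite (Pow (Pow (signed_points n)))" by (auto intro: finite_subset)
qed

lemma finite_NCZ: "finite (NCZ n)"
  using finite_NCB by (auto simp: NCZ_def)

text \<open>A bracket depends on its partition only through image and root, so this is
  \<open>rooted_moment_expansion\<close> read through \<open>NCZ_rooted_bij\<close>.\<close>

lemma bracketB_moment_expansion:
  assumes Q: "Q \<in> NCZ n"
  shows "bracketB n (\<lambda>xs. \<psi> (prod_list xs)) (\<lambda>xs. \<delta> (prod_list xs)) Q a =
    (\<Sum>P | P \<in> NCZ n \<and> refines (signed_points n) P Q.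
       bracketB n (free_cumulant \<psi>) (cyclic_free_cumulant \<psi> \<delta>) P a)"
proof -
  let ?g = "\<lambda>(S, U). cyclic_free_cumulant \<psi> \<delta> (subword a U) *
       (\<Prod>W\<in>S - {U}. free_cumulant \<psi> (cyclic_subword n a U W))"
  have "bracketB n (\<lambda>xs. \<psi> (prod_list xs)) (\<lambda>xs. \<delta> (prod_list xs)) Q a =
    (\<Sum>S | S \<in> NC n \<and> refines {1..n} S (abs_partition Q).
      \<Sum>U | U \<in> S \<and> U \<subseteq> zero_image Q. ?g (S, U))"
    using rooted_moment_expansion[OF NCZ_abs_partition[OF Q] NCZ_zero_image[OF Q], of \<delta> a \<psi>]
    by (simp add: bracketB_def)
  also have "\<dots> = (\<Sum>(S, U)\<in>(SIGMA S:{S \<in> NC n. refines {1..n} S (abs_partition Q)}.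
      {U \<in> S. U \<subseteq> zero_image Q}). ?g (S, U))"
  proof (rule sum.Sigma)
    show "finite {S \<in> NC n. refines {1..n} S (abs_partition Q)}" using finite_NC by simp
    show "\<forall>S\<in>{S \<in> NC n. refines {1..n} S (abs_partition Q)}. finite {U \<in> S. U \<subseteq> zero_image Q}"
      by (auto simp: NC_def dest: finite_elements[rotated])
  qed
  also have "\<dots> = (\<Sum>P | P \<in> NCZ n \<and> refines (signed_points n) P Q. ?g (abs_partition P, zero_image P))"
    using sum.reindex_bij_betw[OF NCZ_rooted_bij[OF Q], of ?g] by (simp add: case_prod_unfold)
  finally show ?thesis by (simp add: bracketB_def)
qed

section \<open>Joins with an interval partition\<close>

text \<open>Two different blocks of the common refinement lie in different blocks of some member of
  \<open>\<P>\<close>, where a crossing between them would already occur.\<close>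

lemma NCB_common_refinement:
  assumes \<P>: "\<P> \<subseteq> NCB n" "\<P> \<noteq> {}"
  shows "common_refinement \<P> \<in> NCB n"
proof -
  have part: "partition_on (signed_points n) P" if "P \<in> \<P>" for P
    using that \<P>(1) NCB_partition by blast
  have "noncrossing (signed_pos n) (common_refinement \<P>)"
    unfolding noncrossing_def
  proof (intro ballI impI notI)
    fix V W assume VW: "V \<in> common_refinement \<P>" "W \<in> common_refinement \<P>" "V \<noteq> W"
      and cr: "\<exists>a\<in>V. \<exists>b\<in>W. \<exists>c\<in>V. \<exists>d\<in>W. signed_pos n a < signed_pos n b \<and>
        signed_pos n b < signed_pos n c \<and> signed_pos n c < signed_pos n d"
    obtain f g where f: "f \<in> (\<Pi> P\<in>\<P>. P)" "V = \<Inter>(f ` \<P>)" and g: "g \<in> (\<Pi> P\<in>\<P>. P)" "W = \<Inter>(g ` \<P>)"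
      using VW(1,2) unfolding common_refinement by blast
    have "\<exists>P\<in>\<P>. f P \<noteq> g P"
    proof (rule ccontr)
      assume "\<not> ?thesis"
      then have "f ` \<P> = g ` \<P>" by (intro image_cong) auto
      then show False using f(2) g(2) VW(3) by simp
    qed
    then obtain P where P: "P \<in> \<P>" "f P \<noteq> g P" by blast
    obtain a b c d where abcd: "a \<in> V" "b \<in> W" "c \<in> V" "d \<in> W" "signed_pos n a < signed_pos n b \<and>
        signed_pos n b < signed_pos n c \<and> signed_pos n c < signed_pos n d"
      using cr by blast
    have "noncrossing (signed_pos n) P" using P(1) \<P>(1) by (auto simp: NCB_def)
    moreover have "f P \<in> P" "g P \<in> P" using f(1) g(1) P(1) by auto
    moreover have "V \<subseteq> f P" "W \<subseteq> g P" using f(2) g(2) P(1) by auto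
    ultimately show False using noncrossingD[of "signed_pos n" P "f P" "g P" a b c d] P(2) abcd by blast
  qed
  moreover have neg: "uminus ` W \<in> common_refinement \<P>" if W: "W \<in> common_refinement \<P>" for W
  proof -
    obtain f where f: "f \<in> (\<Pi> P\<in>\<P>. P)" "W = \<Inter>(f ` \<P>)" "W \<noteq> {}"
      using W unfolding common_refinement by blast
    have "(\<lambda>P. uminus ` f P) \<in> (\<Pi> P\<in>\<P>. P)" using f(1) \<P>(1) NCB_uminus by blast
    moreover obtain P where "P \<in> \<P>" using \<P>(2) by blast
    then have "uminus ` W = \<Inter>((\<lambda>P. uminus ` f P) ` \<P>)"
      unfolding f(2) by (intro image_INT[of _ UNIV]) auto
    ultimately show ?thesis using f(3) unfolding common_refinement by blast
  qed
  moreover have "(`) uminus ` common_refinement \<P> = common_refinement \<P>"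
  proof (intro equalityI subsetI)
    fix W assume W: "W \<in> common_refinement \<P>"
    have "W = uminus ` uminus ` W" by (simp add: image_image)
    then show "W \<in> (`) uminus ` common_refinement \<P>" using neg[OF W] by (metis image_eqI)
  qed (use neg in blast)
  ultimately show ?thesis
    using partition_on_common_refinement[OF part \<P>(2)] by (simp add: NCB_def)
qed

lemma NCB_top: "n \<ge> 1 \<Longrightarrow> {signed_points n} \<in> NCB n"
proof -
  assume "n \<ge> 1"
  then have "1 \<in> signed_points n" by (simp add: signed_points_def)
  then have "signed_points n \<noteq> {}" by blast
  then show ?thesis
    by (simp add: NCB_def partition_on_space noncrossing_def uminus_image_signed_points)
qed

text \<open>The join is a choice among least upper bounds, so one has to be exhibited. It is the
  common refinement of all upper bounds, of which there is at least one, namely the partition with a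
  single block.\<close>

lemma NCB_join_least:
  assumes n: "n \<ge> 1" and P: "P \<in> NCB n" and Q: "Q \<in> NCB n"
  shows "P \<squnion>\<^bsub>NCB_order n\<^esub> Q \<in> NCB n"
    and "refines (signed_points n) P (P \<squnion>\<^bsub>NCB_order n\<^esub> Q)"
    and "refines (signed_points n) Q (P \<squnion>\<^bsub>NCB_order n\<^esub> Q)"
    and "\<And>R. R \<in> NCB n \<Longrightarrow> refines (signed_points n) P R \<Longrightarrow> refines (signed_points n) Q R \<Longrightarrow>
      refines (signed_points n) (P \<squnion>\<^bsub>NCB_order n\<^esub> Q) R"
proof -
  define \<U> where "\<U> = {R \<in> NCB n. refines (signed_points n) P R \<and> refines (signed_points n) Q R}"
  have U: "Upper (NCB_order n) {P, Q} = \<U>"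
    using P Q by (auto simp: Upper_def NCB_order_def \<U>_def)
  have "\<Union>R \<subseteq> signed_points n" if "R \<in> NCB n" for R
    using NCB_partition[OF that] by (auto simp: partition_on_def)
  then have "{signed_points n} \<in> \<U>"
    using NCB_top[OF n] P Q NCB_partition[OF P] NCB_partition[OF Q] NCB_partition[OF NCB_top[OF n]]
    unfolding \<U>_def refines_def by blast
  then have ne: "\<U> \<noteq> {}" by blast
  have sub: "\<U> \<subseteq> NCB n" by (auto simp: \<U>_def)
  have part: "R \<in> \<U> \<Longrightarrow> partition_on (signed_points n) R" for R using sub NCB_partition by blast
  have mem: "common_refinement \<U> \<in> \<U>"
    using NCB_common_refinement[OF sub ne] common_refinement_coarsest[OF part _ _ ne]
      NCB_partition[OF P] NCB_partition[OF Q] by (auto simp: \<U>_def)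
  have "least (NCB_order n) (common_refinement \<U>) \<U>"
    using mem sub refines_common_refinement[OF part] by (auto simp: least_def NCB_order_def)
  then have "least (NCB_order n) (P \<squnion>\<^bsub>NCB_order n\<^esub> Q) \<U>"
    unfolding join_def sup_def U by (rule someI[of "\<lambda>x. least (NCB_order n) x \<U>"])
  then have "P \<squnion>\<^bsub>NCB_order n\<^esub> Q \<in> \<U> \<and> (\<forall>R\<in>\<U>. refines (signed_points n) (P \<squnion>\<^bsub>NCB_order n\<^esub> Q) R)"
    by (simp add: least_def NCB_order_def)
  then show "P \<squnion>\<^bsub>NCB_order n\<^esub> Q \<in> NCB n"
    and "refines (signed_points n) P (P \<squnion>\<^bsub>NCB_order n\<^esub> Q)"
    and "refines (signed_points n) Q (P \<squnion>\<^bsub>NCB_order n\<^esub> Q)"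
    and "\<And>R. R \<in> NCB n \<Longrightarrow> refines (signed_points n) P R \<Longrightarrow> refines (signed_points n) Q R \<Longrightarrow>
      refines (signed_points n) (P \<squnion>\<^bsub>NCB_order n\<^esub> Q) R"
    unfolding \<U>_def by blast+
qed

section \<open>Concatenated words\<close>

lemma sorted_wrt_concat_map:
  assumes "sorted_wrt R ks" "\<And>k. k \<in> set ks \<Longrightarrow> sorted_wrt Q (g k)"
    and "\<And>k l i j. k \<in> set ks \<Longrightarrow> l \<in> set ks \<Longrightarrow> R k l \<Longrightarrow> i \<in> set (g k) \<Longrightarrow> j \<in> set (g l) \<Longrightarrow> Q i j"
  shows "sorted_wrt Q (concat (map g ks))"
  using assms
proof (induction ks)
  case (Cons k ks)
  have "sorted_wrt Q (concat (map g ks))"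
  proof (rule Cons.IH)
    show "Q i j" if "k' \<in> set ks" "l \<in> set ks" "R k' l" "i \<in> set (g k')" "j \<in> set (g l)" for k' l i j
      using that by (intro Cons.prems(3)[of k' l]) simp_all
  qed (use Cons.prems(1,2) in simp_all)
  moreover have "\<forall>i\<in>set (g k). \<forall>j\<in>set (concat (map g ks)). Q i j"
    using Cons.prems(1,3) by fastforce
  ultimately show ?case using Cons.prems(2) by (simp add: sorted_wrt_append)
qed simp

lemma prod_list_concat_map:
  fixes a :: "'b \<Rightarrow> 'a::monoid_mult"
  shows "prod_list (map a (concat (map g ks))) = prod_list (map (\<lambda>k. prod_list (map a (g k))) ks)"
  by (induction ks) simp_all

locale interval_blocks =
  fixes p n :: nat and I :: "nat \<Rightarrow> nat set"
  assumes oip: "ordered_interval_partition p n I"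
begin

definition blk :: "nat \<Rightarrow> nat" where
  "blk i = (THE k. k \<in> {1..n} \<and> i \<in> I k)"

definition sblk :: "int \<Rightarrow> int" where
  "sblk y = (if y > 0 then int (blk (nat y)) else - int (blk (nat (- y))))"

definition npre :: "nat set \<Rightarrow> nat set" where
  "npre V = {i \<in> {1..p}. blk i \<in> V}"

text \<open>Applied to all blocks of a partition this gives its hat, see
  \<open>hat_partition_eq\<close>. Preimages under \<open>sblk\<close> are easier to handle than the
  quotient in \<open>hat_partition\<close>.\<close>

definition spre :: "int set \<Rightarrow> int set" where
  "spre V = {y \<in> signed_points p. sblk y \<in> V}"

section \<open>Indices of intervals and preimages of blocks\<close>

lemma I_partition: "partition_on {1..p} (I ` {1..n})"
  using oip by (simp add: ordered_interval_partition_def)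

lemma I_subset: "k \<in> {1..n} \<Longrightarrow> I k \<subseteq> {1..p}"
  using partition_onD1[OF I_partition] by blast

lemma I_nonempty: "k \<in> {1..n} \<Longrightarrow> I k \<noteq> {}"
  using partition_onD3[OF I_partition] by (metis imageI)

lemma I_cover: "i \<in> {1..p} \<Longrightarrow> \<exists>k\<in>{1..n}. i \<in> I k"
  using partition_onD1[OF I_partition] by blast

lemma I_less: "k \<in> {1..n} \<Longrightarrow> l \<in> {1..n} \<Longrightarrow> k < l \<Longrightarrow> i \<in> I k \<Longrightarrow> j \<in> I l \<Longrightarrow> i < j"
  using oip unfolding ordered_interval_partition_def by blast

lemma blk_eq: "k \<in> {1..n} \<Longrightarrow> i \<in> I k \<Longrightarrow> blk i = k"
  unfolding blk_def
  by (rule the_equality) (use I_less in \<open>metis less_irrefl linorder_neqE_nat\<close>)+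

lemma blk: "i \<in> {1..p} \<Longrightarrow> blk i \<in> {1..n}" "i \<in> {1..p} \<Longrightarrow> i \<in> I (blk i)"
  using I_cover blk_eq by metis+

lemma mem_I_iff: "k \<in> {1..n} \<Longrightarrow> i \<in> I k \<longleftrightarrow> i \<in> {1..p} \<and> blk i = k"
  using blk blk_eq I_subset by blast

lemma blk_mono: "i \<in> {1..p} \<Longrightarrow> j \<in> {1..p} \<Longrightarrow> i < j \<Longrightarrow> blk i \<le> blk j"
  using I_less[of "blk j" "blk i" j i] blk by (metis linorder_not_less order_less_asym)

lemma sblk_uminus: "y \<in> signed_points p \<Longrightarrow> sblk (- y) = - sblk y"
  by (auto simp: sblk_def signed_points_def)

lemma abs_sblk: "y \<in> signed_points p \<Longrightarrow> nat \<bar>sblk y\<bar> = blk (nat \<bar>y\<bar>)"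
  by (auto simp: sblk_def signed_points_def)

lemma sblk_in: "y \<in> signed_points p \<Longrightarrow> sblk y \<in> signed_points n"
  using blk(1)[OF abs_signed_points, of y] by (auto simp: sblk_def signed_points_def)

lemma sblk_mono:
  assumes "x \<in> signed_points p" "y \<in> signed_points p" "signed_pos p x < signed_pos p y"
  shows "signed_pos n (sblk x) \<le> signed_pos n (sblk y)"
proof -
  have b: "blk (nat \<bar>x\<bar>) \<in> {1..n}" "blk (nat \<bar>y\<bar>) \<in> {1..n}"
    using blk(1)[OF abs_signed_points] assms by auto
  have m: "nat \<bar>x\<bar> < nat \<bar>y\<bar> \<Longrightarrow> blk (nat \<bar>x\<bar>) \<le> blk (nat \<bar>y\<bar>)"
    using blk_mono abs_signed_points assms by blast
  show ?thesis
    using b m assms by (auto simp: signed_pos_def sblk_def signed_points_def split: if_splits)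
qed

lemma sblk_surj:
  assumes "k \<in> signed_points n"
  obtains y where "y \<in> signed_points p" "sblk y = k"
proof -
  have k: "nat \<bar>k\<bar> \<in> {1..n}" by (rule abs_signed_points[OF assms])
  obtain i where i: "i \<in> I (nat \<bar>k\<bar>)" using I_nonempty[OF k] by blast
  then have "i \<in> {1..p}" "blk i = nat \<bar>k\<bar>" using mem_I_iff[OF k] by auto
  then have "(if k > 0 then int i else - int i) \<in> signed_points p" "sblk (if k > 0 then int i else - int i) = k"
    using assms by (auto simp: signed_points_def sblk_def)
  then show ?thesis by (rule that)
qed

lemma signed_interval_eq: "k \<in> signed_points n \<Longrightarrow> signed_interval I k = {y \<in> signed_points p. sblk y = k}"
proof (intro equalityI subsetI)
  assume k: "k \<in> signed_points n"
  note k' = abs_signed_points[OF k]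
  show "y \<in> {y \<in> signed_points p. sblk y = k}" if y: "y \<in> signed_interval I k" for y
  proof -
    obtain i where i: "i \<in> I (nat \<bar>k\<bar>)" "y = (if k > 0 then int i else - int i)"
      using y k by (auto simp: signed_interval_def signed_points_def split: if_splits)
    then have "i \<in> {1..p}" "blk i = nat \<bar>k\<bar>" using mem_I_iff[OF k'] by auto
    then show ?thesis using i(2) k by (auto simp: signed_points_def sblk_def)
  qed
  show "y \<in> signed_interval I k" if "y \<in> {y \<in> signed_points p. sblk y = k}" for y
  proof -
    have y: "y \<in> signed_points p" "sblk y = k" using that by auto
    have "nat \<bar>y\<bar> \<in> I (nat \<bar>k\<bar>)"
      using mem_I_iff[OF k'] abs_signed_points[OF y(1)] abs_sblk[OF y(1)] y(2) by auto
    moreover have "0 < k \<longleftrightarrow> 0 < y"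
      using y k blk(1)[OF abs_signed_points[OF y(1)]] by (auto simp: sblk_def signed_points_def split: if_splits)
    moreover have "y \<noteq> 0" "k \<noteq> 0" using y k by (auto simp: signed_points_def)
    ultimately show ?thesis
      by (cases "0 < k") (auto simp: signed_interval_def image_image intro!: image_eqI[of _ _ "nat \<bar>y\<bar>"])
  qed
qed

lemma sblk_spre: "V \<subseteq> signed_points n \<Longrightarrow> sblk ` spre V = V"
  unfolding spre_def using sblk_surj by blast

lemma spre_mono_iff: "V \<subseteq> signed_points n \<Longrightarrow> spre V \<subseteq> spre W \<longleftrightarrow> V \<subseteq> W"
  unfolding spre_def using sblk_surj by blast

lemma spre_uminus: "uminus ` spre V = spre (uminus ` V)"
proof (intro equalityI subsetI)
  show "y \<in> spre (uminus ` V)" if "y \<in> uminus ` spre V" for y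
    using that sblk_uminus uminus_signed_points by (auto simp: spre_def)
  show "y \<in> uminus ` spre V" if y: "y \<in> spre (uminus ` V)" for y
  proof -
    have "- y \<in> spre V" using y sblk_uminus uminus_signed_points by (auto simp: spre_def)
    then show ?thesis by (rule rev_image_eqI) simp
  qed
qed

lemma spre_partition:
  assumes "partition_on (signed_points n) P"
  shows "partition_on (signed_points p) (spre ` P)"
proof (rule partition_onI)
  have P: "V \<subseteq> signed_points n" "V \<noteq> {}" if "V \<in> P" for V using assms that by (auto simp: partition_on_def)
  show "\<Union>(spre ` P) = signed_points p"
  proof (intro equalityI subsetI)
    fix y assume y: "y \<in> signed_points p"
    obtain V where "V \<in> P" "sblk y \<in> V" by (rule partition_on_obtains[OF assms sblk_in[OF y]])
    then show "y \<in> \<Union>(spre ` P)" using y by (auto simp: spre_def)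
  qed (auto simp: spre_def)
  have "spre V \<noteq> {}" if "V \<in> P" for V using sblk_spre[OF P(1)[OF that]] P(2)[OF that] by auto
  then show "{} \<notin> spre ` P" by blast
  fix A B assume "A \<in> spre ` P" "B \<in> spre ` P" "A \<noteq> B"
  then obtain V W where VW: "V \<in> P" "W \<in> P" "V \<noteq> W" "A = spre V" "B = spre W" by blast
  then show "disjnt A B"
    using partition_on_block_eq[OF assms VW(1,2)] by (auto simp: spre_def disjnt_iff)
qed

text \<open>Points in different preimages have different indices. On them the weak monotonicity of
  \<open>sblk\<close> is strict, and a crossing of preimages maps to a crossing of
  \<open>P\<close>.\<close>

lemma spre_NCB:
  assumes P: "P \<in> NCB n"
  shows "spre ` P \<in> NCB p"
proof -
  have sub: "V \<subseteq> signed_points n" if "V \<in> P" for V by (rule NCB_block_subset[OF P that])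
  have "noncrossing (signed_pos n) P" using P by (simp add: NCB_def)
  then have "noncrossing (signed_pos p) (spre ` P)"
  proof (rule noncrossing_transfer[where h = "(`) sblk" and f = sblk])
    show "sblk ` V \<in> P" if V: "V \<in> spre ` P" for V using V by (rule imageE) (simp add: sblk_spre sub)
    show "inj_on ((`) sblk) (spre ` P)"
      by (rule inj_on_inverseI[where g = spre]) (elim imageE, simp only: sblk_spre sub)
    fix V W x y assume "V \<in> spre ` P" "W \<in> spre ` P" "V \<noteq> W" and xy: "x \<in> V" "y \<in> W"
      and less: "signed_pos p x < signed_pos p y"
    then obtain V' W' where VW: "V' \<in> P" "W' \<in> P" "V = spre V'" "W = spre W'" "V' \<noteq> W'" by blast
    then have s: "x \<in> signed_points p" "y \<in> signed_points p" "sblk x \<in> V'" "sblk y \<in> W'"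
      using xy by (auto simp: spre_def)
    then have "sblk x \<noteq> sblk y"
      using partition_on_block_eq[OF NCB_partition[OF P] VW(1,2)] VW(5) by metis
    then have "signed_pos n (sblk x) \<noteq> signed_pos n (sblk y)"
      using signed_pos_inj[OF sblk_in sblk_in] s by blast
    then show "signed_pos n (sblk x) < signed_pos n (sblk y)"
      using sblk_mono[OF s(1,2) less] by simp
  qed auto
  moreover have "(`) uminus ` spre ` P = spre ` (`) uminus ` P"
    by (simp add: image_image spre_uminus)
  ultimately show ?thesis using spre_partition[OF NCB_partition[OF P]] P by (simp add: NCB_def)
qed

lemma spre_zero_block: "zero_block Z \<Longrightarrow> zero_block (spre Z)"
  by (simp add: zero_block_def spre_uminus)

lemma spre_NCZ: "P \<in> NCZ n \<Longrightarrow> spre ` P \<in> NCZ p"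
  using spre_NCB spre_zero_block unfolding NCZ_def by blast

section \<open>Hats and the partitions above the interval partition\<close>

lemma hat_partition_eq:
  assumes P: "P \<in> NCB n"
  shows "hat_partition p n I P = spre ` P"
proof -
  have "(\<exists>k\<in>signed_points n. \<exists>l\<in>signed_points n.
      i \<in> signed_interval I k \<and> j \<in> signed_interval I l \<and> (\<exists>V\<in>P. k \<in> V \<and> l \<in> V)) \<longleftrightarrow>
    (\<exists>q\<in>spre ` P. i \<in> q \<and> j \<in> q)" for i j
  proof
    assume "\<exists>k\<in>signed_points n. \<exists>l\<in>signed_points n.
      i \<in> signed_interval I k \<and> j \<in> signed_interval I l \<and> (\<exists>V\<in>P. k \<in> V \<and> l \<in> V)"
    then obtain V where "V \<in> P" "i \<in> spre V" "j \<in> spre V"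
      by (auto simp: signed_interval_eq spre_def)
    then show "\<exists>q\<in>spre ` P. i \<in> q \<and> j \<in> q" by blast
  next
    assume "\<exists>q\<in>spre ` P. i \<in> q \<and> j \<in> q"
    then obtain V where V: "V \<in> P" "i \<in> signed_points p" "sblk i \<in> V" "j \<in> signed_points p" "sblk j \<in> V"
      by (auto simp: spre_def)
    then have "i \<in> signed_interval I (sblk i)" "j \<in> signed_interval I (sblk j)"
      by (simp_all add: signed_interval_eq sblk_in)
    then show "\<exists>k\<in>signed_points n. \<exists>l\<in>signed_points n.
      i \<in> signed_interval I k \<and> j \<in> signed_interval I l \<and> (\<exists>V\<in>P. k \<in> V \<and> l \<in> V)"
      using V sblk_in by blast
  qed
  then show ?thesis
    using partition_on_eq_quotient[OF spre_partition[OF NCB_partition[OF P]]]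
    unfolding hat_partition_def by simp
qed

lemma refines_spre_iff:
  assumes "partition_on (signed_points n) P" "partition_on (signed_points n) Q"
  shows "refines (signed_points p) (spre ` P) (spre ` Q) \<longleftrightarrow> refines (signed_points n) P Q"
proof -
  have "V \<subseteq> signed_points n" if "V \<in> P" for V using assms(1) that by (auto simp: partition_on_def)
  then show ?thesis
    using spre_partition assms spre_mono_iff unfolding refines_def by auto
qed

lemma spre_inj: "inj_on ((`) spre) (NCB n)"
proof (rule inj_onI)
  fix P Q assume PQ: "P \<in> NCB n" "Q \<in> NCB n" "spre ` P = spre ` Q"
  have "(`) sblk ` spre ` R = R" if "R \<in> NCB n" for R
    unfolding image_image using sblk_spre NCB_block_subset[OF that] by (simp cong: image_cong)
  then show "P = Q" using PQ by metis
qed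

lemma singletons_NCB: "(\<lambda>k. {k}) ` signed_points n \<in> NCB n"
proof -
  have "(`) uminus ` (\<lambda>k. {k}) ` signed_points n = (\<lambda>k. {k}) ` uminus ` signed_points n"
    by (simp add: image_image)
  also have "uminus ` signed_points n = signed_points n" by (rule uminus_image_signed_points)
  finally show ?thesis by (auto simp: NCB_def partition_on_singletons noncrossing_def)
qed

text \<open>The interval partition is the hat of the finest partition, so that its properties become
  special cases of those of hats.\<close>

lemma barI_eq: "barI n I = spre ` (\<lambda>k. {k}) ` signed_points n"
  unfolding barI_def image_image by (intro image_cong) (auto simp: signed_interval_eq spre_def)

lemma barI_NCB: "barI n I \<in> NCB p"
  unfolding barI_eq by (rule spre_NCB[OF singletons_NCB])

lemma barI_refines_spre:
  assumes "P \<in> NCB n"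
  shows "refines (signed_points p) (barI n I) (spre ` P)"
proof -
  have "refines (signed_points n) ((\<lambda>k. {k}) ` signed_points n) P"
    using NCB_partition[OF assms] partition_on_singletons unfolding refines_def partition_on_def by auto
  then show ?thesis
    unfolding barI_eq using refines_spre_iff NCB_partition[OF singletons_NCB] NCB_partition[OF assms] by blast
qed

text \<open>A block of \<open>Q\<close> that contains one point of a signed interval contains all of
  it, by \<open>same\<close>, hence is the preimage of its image under \<open>sblk\<close>. In
  particular every join with \<open>barI n I\<close> is a hat.\<close>

lemma coarser_than_barI:
  assumes Q: "Q \<in> NCB p" and ref: "refines (signed_points p) (barI n I) Q"
  obtains P where "P \<in> NCB n" "Q = spre ` P"
proof -
  define P where "P = (`) sblk ` Q"
  note partQ = NCB_partition[OF Q]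
  have same: "y \<in> W" if "W \<in> Q" "w \<in> W" "y \<in> signed_points p" "sblk y = sblk w" for W w y
  proof -
    have w: "w \<in> signed_points p" using that NCB_block_subset[OF Q] by blast
    then have "{z \<in> signed_points p. sblk z = sblk w} \<in> barI n I"
      unfolding barI_def using signed_interval_eq sblk_in by blast
    then obtain W' where W': "W' \<in> Q" "{z \<in> signed_points p. sblk z = sblk w} \<subseteq> W'"
      using ref by (auto simp: refines_def)
    then have "w \<in> W'" "y \<in> W'" using w that by auto
    then show ?thesis using partition_on_block_eq[OF partQ that(1) W'(1) that(2)] by simp
  qed
  have spre_img: "spre (sblk ` W) = W" if "W \<in> Q" for W
    unfolding spre_def using same[OF that] NCB_block_subset[OF Q that] by blast
  have QP: "Q = spre ` P" unfolding P_def image_image using spre_img by (simp cong: image_cong)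
  have "partition_on (signed_points n) P"
  proof (rule partition_onI)
    have "\<Union>P = sblk ` \<Union>Q" by (auto simp: P_def)
    also have "\<dots> = sblk ` signed_points p" using partQ by (simp add: partition_on_def)
    also have "\<dots> = signed_points n" using sblk_in sblk_surj by blast
    finally show "\<Union>P = signed_points n" .
    show "{} \<notin> P" using partQ by (auto simp: P_def partition_on_def)
    fix A B assume "A \<in> P" "B \<in> P" "A \<noteq> B"
    then obtain V W where VW: "V \<in> Q" "W \<in> Q" "A = sblk ` V" "B = sblk ` W" "V \<noteq> W" by (auto simp: P_def)
    show "disjnt A B"
    proof (rule ccontr)
      assume "\<not> disjnt A B"
      then obtain z where "z \<in> A" "z \<in> B" by (auto simp: disjnt_iff)
      then obtain x y where "x \<in> V" "z = sblk x" "y \<in> W" "z = sblk y" unfolding VW(3,4) by blast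
      then have xy: "x \<in> V" "y \<in> W" "sblk y = sblk x" by simp_all
      then have "y \<in> V" using same[OF VW(1) xy(1)] NCB_block_subset[OF Q VW(2)] by blast
      then show False using partition_on_block_eq[OF partQ VW(1,2)] xy VW by blast
    qed
  qed
  moreover have "noncrossing (signed_pos n) P"
  proof -
    \<comment> \<open>One representative of each signed interval suffices to carry a crossing of
      \<open>P\<close> to \<open>Q\<close>: the contrapositive of \<open>sblk_mono\<close> makes
      \<open>rep\<close> strictly increasing.\<close>
    define rep where "rep k = (SOME y. y \<in> signed_points p \<and> sblk y = k)" for k
    have rep: "rep k \<in> signed_points p" "sblk (rep k) = k" if "k \<in> signed_points n" for k
      using sblk_surj[OF that] someI_ex[of "\<lambda>y. y \<in> signed_points p \<and> sblk y = k"] unfolding rep_def by blast+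
    have subP: "A \<subseteq> signed_points n" if "A \<in> P" for A
      using \<open>partition_on (signed_points n) P\<close> that by (auto simp: partition_on_def)
    have "noncrossing (signed_pos p) Q" using Q by (simp add: NCB_def)
    then show ?thesis
    proof (rule noncrossing_transfer[where h = spre and f = rep])
      show "spre A \<in> Q" if "A \<in> P" for A using that QP by blast
      show "rep x \<in> spre A" if "A \<in> P" "x \<in> A" for A x
        using that rep subP[OF that(1)] by (auto simp: spre_def)
      show "inj_on spre P" 
        by (rule inj_on_inverseI[where g = "(`) sblk"]) (rule sblk_spre[OF subP])
      fix V W x y assume "V \<in> P" "W \<in> P" "x \<in> V" "y \<in> W" and less: "signed_pos n x < signed_pos n y"
      then have xy: "x \<in> signed_points n" "y \<in> signed_points n" using subP by blast+
      show "signed_pos p (rep x) < signed_pos p (rep y)"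
        using sblk_mono[OF rep(1)[OF xy(2)] rep(1)[OF xy(1)]] rep(2)[OF xy(1)] rep(2)[OF xy(2)] less
          signed_pos_inj[OF rep(1)[OF xy(1)] rep(1)[OF xy(2)]]
        by (metis linorder_neqE_nat less_irrefl linorder_not_less)
    qed
  qed
  moreover have "(`) uminus ` P = P"
  proof -
    have "uminus ` sblk ` W = sblk ` uminus ` W" if "W \<in> Q" for W
      unfolding image_image using sblk_uminus NCB_block_subset[OF Q that]
      by (intro image_cong) auto
    then have "(`) uminus ` P = (`) sblk ` (`) uminus ` Q"
      unfolding P_def by (force simp: image_image)
    then show ?thesis using Q by (simp add: NCB_def P_def)
  qed
  ultimately have "P \<in> NCB n" by (simp add: NCB_def)
  then show ?thesis using QP by (rule that)
qed

lemma spre_NCZ_iff: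
  assumes P: "P \<in> NCB n" and "spre ` P \<in> NCZ p"
  shows "P \<in> NCZ n"
proof -
  obtain Z where Z: "Z \<in> P" "uminus ` spre Z = spre Z"
    using assms(2) by (auto simp: NCZ_def zero_block_def)
  have "uminus ` Z \<in> P" by (rule NCB_uminus[OF P Z(1)])
  moreover have "spre (uminus ` Z) = spre Z" using Z(2) spre_uminus by simp
  ultimately have "uminus ` Z = Z" using sblk_spre NCB_block_subset[OF P] Z(1) by metis
  then show ?thesis using P Z(1) unfolding NCZ_def zero_block_def by blast
qed

lemma abs_spre:
  assumes "V \<subseteq> signed_points n"
  shows "abs_block (spre V) = npre (abs_block V)"
proof (intro equalityI subsetI)
  fix x assume "x \<in> abs_block (spre V)"
  then obtain y where y: "y \<in> signed_points p" "sblk y \<in> V" "x = nat \<bar>y\<bar>"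
    by (auto simp: abs_block_def spre_def)
  then show "x \<in> npre (abs_block V)"
    using abs_signed_points[OF y(1)] abs_sblk[OF y(1)] by (force simp: npre_def abs_block_def)
next
  fix x assume "x \<in> npre (abs_block V)"
  then obtain k where k: "x \<in> {1..p}" "k \<in> V" "blk x = nat \<bar>k\<bar>" by (auto simp: npre_def abs_block_def)
  define y where "y = (if k > 0 then int x else - int x)"
  have "k \<noteq> 0" using k(2) assms by (auto simp: signed_points_def)
  then have "y \<in> spre V" "x = nat \<bar>y\<bar>"
    using k by (auto simp: y_def spre_def sblk_def signed_points_def)
  then show "x \<in> abs_block (spre V)" unfolding abs_block_def by (rule rev_image_eqI)
qed

lemma abs_partition_spre: "P \<in> NCB n \<Longrightarrow> abs_partition (spre ` P) = npre ` abs_partition P"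
  unfolding abs_partition_def image_image using abs_spre NCB_block_subset by (intro image_cong) auto

lemma zero_image_spre:
  assumes "P \<in> NCZ n"
  shows "zero_image (spre ` P) = npre (zero_image P)"
proof -
  obtain Z where Z: "P \<in> NCB n" "Z \<in> P" "zero_block Z" "zero_image P = abs_block Z"
    by (rule NCZ_E[OF assms])
  have "zero_image (spre ` P) = abs_block (spre Z)"
    by (rule zero_image_eq[OF spre_NCB[OF Z(1)] imageI[OF Z(2)] spre_zero_block[OF Z(3)]])
  then show ?thesis using abs_spre[OF NCB_block_subset[OF Z(1,2)]] Z(4) by simp
qed

section \<open>Products of letters grouped by intervals\<close>

lemma npre_eq: "V \<subseteq> {1..n} \<Longrightarrow> npre V = (\<Union>k\<in>V. I k)"
proof (intro equalityI subsetI)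
  assume V: "V \<subseteq> {1..n}"
  show "i \<in> (\<Union>k\<in>V. I k)" if "i \<in> npre V" for i
    using that blk(2)[of i] unfolding npre_def by blast
  show "i \<in> npre V" if i: "i \<in> (\<Union>k\<in>V. I k)" for i
  proof -
    obtain k where "k \<in> V" "i \<in> I k" using i by blast
    then show ?thesis using mem_I_iff[of k i] V unfolding npre_def by blast
  qed
qed

lemma finite_I: "k \<in> {1..n} \<Longrightarrow> finite (I k)"
  using I_subset finite_subset by blast

text \<open>Under these conditions on \<open>key\<close>, the word \<open>ys\<close> is the
  concatenation of the intervals with index in \<open>xs\<close>, so its product splits. The order
  \<open>key\<close> is left open to cover both the natural order, for the root, and the order of a
  cut circle, for the other blocks.\<close>

lemma word_blocks:
  fixes key :: "nat \<Rightarrow> nat"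
  assumes xs: "sorted_wrt R xs" "set xs = V" "V \<subseteq> {1..n}"
    and ys: "sorted_wrt (\<lambda>i j. key i < key j) ys" "set ys = npre V"
    and within: "\<And>k i j. k \<in> V \<Longrightarrow> i \<in> I k \<Longrightarrow> j \<in> I k \<Longrightarrow> i < j \<Longrightarrow> key i < key j"
    and across: "\<And>k l i j. k \<in> V \<Longrightarrow> l \<in> V \<Longrightarrow> R k l \<Longrightarrow> i \<in> I k \<Longrightarrow> j \<in> I l \<Longrightarrow> key i < key j"
  shows "prod_list (map a ys) = prod_list (map (\<lambda>k. prod_list (subword a (I k))) xs)"
proof -
  let ?g = "\<lambda>k. sorted_list_of_set (I k)"
  have fin: "finite (I k)" if "k \<in> V" for k using finite_I xs(3) that by blast
  have "sorted_wrt (\<lambda>i j. key i < key j) (concat (map ?g xs))"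
  proof (rule sorted_wrt_concat_map[OF xs(1)])
    show "sorted_wrt (\<lambda>i j. key i < key j) (?g k)" if "k \<in> set xs" for k
      by (rule sorted_wrt_mono_rel[OF _ strict_sorted_list_of_set]) (use that xs(2) fin within in auto)
  qed (use xs(2) fin across in auto)
  moreover have "set (concat (map ?g xs)) = set ys"
    using fin xs(2) npre_eq[OF xs(3)] ys(2) by auto
  ultimately have "ys = concat (map ?g xs)" using sorted_wrt_key_unique ys(1) by metis
  then show ?thesis by (simp add: prod_list_concat_map subword_def)
qed

lemma subword_npre:
  assumes "V \<subseteq> {1..n}"
  shows "prod_list (subword a (npre V)) = prod_list (subword (\<lambda>k. prod_list (subword a (I k))) V)"
  unfolding subword_def[of a "npre V"] subword_def[of _ V]
proof (rule word_blocks[where key = "\<lambda>i. i" and R = "(<)" and V = V])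
  have "finite V" "finite (npre V)" using assms finite_subset by (auto simp: npre_def)
  then show "set (sorted_list_of_set V) = V" "set (sorted_list_of_set (npre V)) = npre V" by auto
  show "i < j" if "k \<in> V" "l \<in> V" "k < l" "i \<in> I k" "j \<in> I l" for k l i j
    using I_less[of k l i j] that assms by blast
qed (use assms in auto)

text \<open>Cutting in front of \<open>Min (I v)\<close> leaves every interval in one piece, on the
  same side of the cut as its index; this is the content of \<open>ge\<close>. The natural order
  inside an interval therefore survives the cut.\<close>

lemma cword_npre:
  assumes V: "V \<subseteq> {1..n}" and v: "v \<in> {1..n}"
  shows "prod_list (cword p a (Min (I v)) (npre V)) = prod_list (cword n (\<lambda>k. prod_list (subword a (I k))) v V)"
  unfolding cword_def
proof (rule word_blocks[where key = "cpos p (Min (I v))" and R = "\<lambda>k l. cpos n v k < cpos n v l" and V = V])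
  let ?u = "Min (I v)"
  have u: "?u \<in> I v" using finite_I[OF v] I_nonempty[OF v] by (rule Min_in)
  then have up: "?u \<in> {1..p}" using I_subset[OF v] by blast
  have ge: "?u \<le> i \<longleftrightarrow> v \<le> k" if "k \<in> {1..n}" "i \<in> I k" for k i
  proof (cases k v rule: linorder_cases)
    case less
    then show ?thesis using I_less[OF that(1) v less that(2) u] by auto
  next
    case equal
    then show ?thesis using that finite_I[OF v] by simp
  next
    case greater
    then show ?thesis using I_less[OF v that(1) greater u that(2)] by auto
  qed
  show "sorted_wrt (\<lambda>k l. cpos n v k < cpos n v l) (filter (\<lambda>i. i \<in> V) (rot n v))"
    "sorted_wrt (\<lambda>k l. cpos p ?u k < cpos p ?u l) (filter (\<lambda>i. i \<in> npre V) (rot p ?u))"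
    using v up by (auto intro!: sorted_wrt_filter sorted_rot)
  show "set (filter (\<lambda>i. i \<in> V) (rot n v)) = V" using V v by (auto simp: set_rot)
  show "set (filter (\<lambda>i. i \<in> npre V) (rot p ?u)) = npre V" using up by (auto simp: set_rot npre_def)
  show "cpos p ?u i < cpos p ?u j" if "k \<in> V" "i \<in> I k" "j \<in> I k" "i < j" for k i j
  proof -
    have k: "k \<in> {1..n}" using that V by blast
    show ?thesis using ge[OF k that(2)] ge[OF k that(3)] that(4) by (auto simp: cpos_def)
  qed
  show "cpos p ?u i < cpos p ?u j"
    if h: "k \<in> V" "l \<in> V" "cpos n v k < cpos n v l" "i \<in> I k" "j \<in> I l" for k l i j
  proof -
    have kl: "k \<in> {1..n}" "l \<in> {1..n}" using h V by blast+
    then have "i \<in> {1..p}" "j \<in> {1..p}" using I_subset h by blast+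
    then show ?thesis
      using ge[OF kl(1) h(4)] ge[OF kl(2) h(5)] I_less[OF kl _ h(4,5)] h(3) kl
      by (auto simp: cpos_def not_le split: if_splits)
  qed
qed (rule V)

lemma npre_inj: "inj_on npre (Pow {1..n})"
proof (rule inj_on_inverseI[where g = "(`) blk"])
  fix V assume "V \<in> Pow {1..n}"
  then have V: "V \<subseteq> {1..n}" by simp
  have "V \<subseteq> blk ` npre V"
  proof
    fix k assume k: "k \<in> V"
    then obtain i where "i \<in> I k" using I_nonempty V by blast
    then have "i \<in> {1..p}" "blk i = k" using mem_I_iff[of k i] k V by blast+
    then have "i \<in> npre V" "k = blk i" using k by (auto simp: npre_def)
    then show "k \<in> blk ` npre V" by (rule rev_image_eqI)
  qed
  then show "blk ` npre V = V" by (auto simp: npre_def)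
qed

text \<open>Here the special shape of moments enters: both functionals see only the product of a
  word. A cut point \<open>v\<close> of the root is matched by the cut point
  \<open>Min (I v)\<close> in the root of the hat.\<close>

lemma bracketB_spre:
  assumes P: "P \<in> NCZ n"
  shows "bracketB p (\<lambda>xs. \<psi> (prod_list xs)) (\<lambda>xs. \<delta> (prod_list xs)) (spre ` P) a =
    bracketB n (\<lambda>xs. \<psi> (prod_list xs)) (\<lambda>xs. \<delta> (prod_list xs)) P (\<lambda>k. prod_list (subword a (I k)))"
proof -
  let ?O = "zero_image P" and ?S = "abs_partition P"
  have PB: "P \<in> NCB n" using P by (simp add: NCZ_def)
  have NC: "?S \<in> NC n" and O: "?O \<in> ?S" using NCZ_abs_partition[OF P] NCZ_zero_image[OF P] by auto
  have NC': "npre ` ?S \<in> NC p"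
    using NCZ_abs_partition[OF spre_NCZ[OF P]] abs_partition_spre[OF PB] by simp
  have sub: "V \<subseteq> {1..n}" if "V \<in> ?S" for V using NC that by (auto simp: NC_def partition_on_def)
  then have inj: "inj_on npre ?S" by (intro inj_on_subset[OF npre_inj]) auto
  obtain v where v: "v \<in> ?O" using NCZ_zero_image_nonempty[OF P] by blast
  then have v1: "v \<in> {1..n}" using sub O by blast
  have "Min (I v) \<in> I v" using finite_I[OF v1] I_nonempty[OF v1] by (rule Min_in)
  then have u: "Min (I v) \<in> npre ?O" using npre_eq[OF sub[OF O]] v by blast
  have cyc: "prod_list (cyclic_subword p a (npre ?O) (npre V)) =
      prod_list (cyclic_subword n (\<lambda>k. prod_list (subword a (I k))) ?O V)" if V: "V \<in> ?S" "V \<noteq> ?O" for V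
  proof -
    have "npre ?O \<noteq> npre V" using inj V O by (auto dest: inj_onD)
    then have "cyclic_subword p a (npre ?O) (npre V) = cword p a (Min (I v)) (npre V)"
      using cyclic_subword_eq_cword[OF NC' imageI[OF O] imageI[OF V(1)] _ u] by blast
    moreover have "cyclic_subword n b ?O V = cword n b v V" for b :: "nat \<Rightarrow> 'a"
      using cyclic_subword_eq_cword[OF NC O V(1) V(2)[symmetric] v] .
    ultimately show ?thesis using cword_npre[OF sub[OF V(1)] v1] by simp
  qed
  have "npre ` ?S - {npre ?O} = npre ` (?S - {?O})"
    using inj O by (auto dest: inj_onD)
  then have "(\<Prod>V\<in>npre ` ?S - {npre ?O}. \<psi> (prod_list (cyclic_subword p a (npre ?O) V))) =
    (\<Prod>V\<in>?S - {?O}. \<psi> (prod_list (cyclic_subword p a (npre ?O) (npre V))))"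
    using inj_on_subset[OF inj, of "?S - {?O}"] by (simp add: prod.reindex)
  also have "\<dots> = (\<Prod>V\<in>?S - {?O}. \<psi> (prod_list (cyclic_subword n (\<lambda>k. prod_list (subword a (I k))) ?O V)))"
    by (intro prod.cong[OF refl]) (metis cyc DiffD1 DiffD2 singletonI)
  finally show ?thesis
    unfolding bracketB_def abs_partition_spre[OF PB] zero_image_spre[OF P] subword_npre[OF sub[OF O]]
    by simp
qed

text \<open>The join lies above \<open>barI n I\<close>, hence is a hat. Its universal property then
  yields the adjunction between \<open>\<sigma> \<mapsto> \<rho>\<close> and the hat that the last
  clause expresses.\<close>

lemma join_barI:
  assumes p: "p \<ge> 1" and \<sigma>: "\<sigma> \<in> NCZ p"
  obtains \<rho> where "\<rho> \<in> NCZ n" "\<sigma> \<squnion>\<^bsub>NCB_order p\<^esub> barI n I = spre ` \<rho>"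
    "\<And>\<pi>. \<pi> \<in> NCZ n \<Longrightarrow> refines (signed_points p) \<sigma> (spre ` \<pi>) \<longleftrightarrow> refines (signed_points n) \<rho> \<pi>"
proof -
  let ?J = "\<sigma> \<squnion>\<^bsub>NCB_order p\<^esub> barI n I"
  have \<sigma>B: "\<sigma> \<in> NCB p" using \<sigma> by (simp add: NCZ_def)
  note J = NCB_join_least[OF p \<sigma>B barI_NCB]
  obtain \<rho> where \<rho>: "\<rho> \<in> NCB n" "?J = spre ` \<rho>" by (rule coarser_than_barI[OF J(1,3)])
  have \<rho>Z: "\<rho> \<in> NCZ n" using spre_NCZ_iff[OF \<rho>(1)] refines_NCZ[OF \<sigma> J(1,2)] \<rho>(2) by simp
  have "refines (signed_points p) \<sigma> (spre ` \<pi>) \<longleftrightarrow> refines (signed_points n) \<rho> \<pi>" if "\<pi> \<in> NCZ n" for \<pi>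
  proof -
    have \<pi>: "\<pi> \<in> NCB n" using that by (simp add: NCZ_def)
    have "refines (signed_points p) \<sigma> (spre ` \<pi>) \<longleftrightarrow> refines (signed_points p) ?J (spre ` \<pi>)"
      using J(4)[OF spre_NCB[OF \<pi>] _ barI_refines_spre[OF \<pi>]] refines_trans[OF J(2)] by blast
    then show ?thesis using refines_spre_iff[OF NCB_partition[OF \<rho>(1)] NCB_partition[OF \<pi>]] \<rho>(2) by simp
  qed
  then show ?thesis using that \<rho>Z \<rho>(2) by blast
qed

text \<open>The inner sums run over the fibres of the map \<open>\<sigma> \<mapsto> \<rho>\<close>
  of \<open>join_barI\<close>; they are disjoint because the hat is injective.\<close>

lemma sum_over_joins:
  assumes p: "p \<ge> 1" and \<pi>: "\<pi> \<in> NCZ n"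
  shows "(\<Sum>\<sigma> | \<sigma> \<in> NCZ p \<and> refines (signed_points p) \<sigma> (spre ` \<pi>). F \<sigma>) =
    (\<Sum>\<rho> | \<rho> \<in> NCZ n \<and> refines (signed_points n) \<rho> \<pi>.
      \<Sum>\<sigma> | \<sigma> \<in> NCZ p \<and> \<sigma> \<squnion>\<^bsub>NCB_order p\<^esub> barI n I = spre ` \<rho>. F \<sigma>)"
    (is "sum F ?A = (\<Sum>\<rho>\<in>?B. sum F (?C \<rho>))")
proof -
  have NCZB: "\<rho> \<in> NCZ n \<Longrightarrow> \<rho> \<in> NCB n" for \<rho> by (simp add: NCZ_def)
  have "?A = (\<Union>\<rho>\<in>?B. ?C \<rho>)"
  proof (intro equalityI subsetI)
    fix \<sigma> assume \<sigma>: "\<sigma> \<in> ?A"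
    then have "\<sigma> \<in> NCZ p" by simp
    then obtain \<rho> where "\<rho> \<in> NCZ n" "\<sigma> \<squnion>\<^bsub>NCB_order p\<^esub> barI n I = spre ` \<rho>"
      "refines (signed_points p) \<sigma> (spre ` \<pi>) \<longleftrightarrow> refines (signed_points n) \<rho> \<pi>"
      using join_barI[OF p, of \<sigma>] \<pi> by metis
    then show "\<sigma> \<in> (\<Union>\<rho>\<in>?B. ?C \<rho>)" using \<sigma> by blast
  next
    fix \<sigma> assume "\<sigma> \<in> (\<Union>\<rho>\<in>?B. ?C \<rho>)"
    then obtain \<rho> where \<rho>: "\<rho> \<in> ?B" "\<sigma> \<in> NCZ p" "\<sigma> \<squnion>\<^bsub>NCB_order p\<^esub> barI n I = spre ` \<rho>" by blast
    obtain \<rho>' where \<rho>': "\<rho>' \<in> NCZ n" "\<sigma> \<squnion>\<^bsub>NCB_order p\<^esub> barI n I = spre ` \<rho>'"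
      "refines (signed_points p) \<sigma> (spre ` \<pi>) \<longleftrightarrow> refines (signed_points n) \<rho>' \<pi>"
      using join_barI[OF p \<rho>(2)] \<pi> by metis
    have "\<rho>' = \<rho>" using inj_onD[OF spre_inj, of \<rho>' \<rho>] \<rho> \<rho>' NCZB by auto
    then show "\<sigma> \<in> ?A" using \<rho> \<rho>' by simp
  qed
  then have "sum F ?A = sum F (\<Union>\<rho>\<in>?B. ?C \<rho>)" by simp
  also have "\<dots> = (\<Sum>\<rho>\<in>?B. sum F (?C \<rho>))"
  proof (rule sum.UNION_disjoint)
    show "finite ?B" using finite_NCZ by simp
    show "\<forall>\<rho>\<in>?B. finite (?C \<rho>)" using finite_NCZ by simp
    show "\<forall>\<rho>\<in>?B. \<forall>\<rho>'\<in>?B. \<rho> \<noteq> \<rho>' \<longrightarrow> ?C \<rho> \<inter> ?C \<rho>' = {}"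
    proof (intro ballI impI)
      fix \<rho> \<rho>' assume "\<rho> \<in> ?B" "\<rho>' \<in> ?B" "\<rho> \<noteq> \<rho>'"
      then have "spre ` \<rho> \<noteq> spre ` \<rho>'" using inj_onD[OF spre_inj, of \<rho> \<rho>'] NCZB by blast
      then show "?C \<rho> \<inter> ?C \<rho>' = {}"
        by (intro equals0I, elim IntE CollectE conjE) metis
    qed
  qed
  finally show ?thesis .
qed

end

text \<open>This is the uniqueness half of Moebius inversion on a finite order. The induction runs
  on the number of refinements, which drops strictly below \<open>\<pi>\<close> because
  \<open>\<pi>\<close> itself is lost.\<close>

lemma eq_if_sums_over_refinements_eq:
  fixes F G :: "int set set \<Rightarrow> 'b::ab_group_add"
  assumes sums: "\<And>\<pi>. \<pi> \<in> NCZ n \<Longrightarrow>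
      (\<Sum>\<rho> | \<rho> \<in> NCZ n \<and> refines (signed_points n) \<rho> \<pi>. F \<rho>) =
      (\<Sum>\<rho> | \<rho> \<in> NCZ n \<and> refines (signed_points n) \<rho> \<pi>. G \<rho>)"
    and "\<pi> \<in> NCZ n"
  shows "F \<pi> = G \<pi>"
  using assms(2)
proof (induction "card {\<rho>. \<rho> \<in> NCZ n \<and> refines (signed_points n) \<rho> \<pi>}" arbitrary: \<pi> rule: less_induct)
  case less
  let ?D = "\<lambda>\<pi>. {\<rho>. \<rho> \<in> NCZ n \<and> refines (signed_points n) \<rho> \<pi>}"
  have refines_self: "refines (signed_points n) \<rho> \<rho>" if "\<rho> \<in> NCZ n" for \<rho>
    using that by (intro refines_refl NCB_partition) (simp add: NCZ_def)
  have fin: "finite (?D \<pi>)" for \<pi> using finite_NCZ by simp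
  have mem: "\<pi> \<in> ?D \<pi>" using less.prems refines_self by simp
  have "F \<rho> = G \<rho>" if \<rho>: "\<rho> \<in> ?D \<pi> - {\<pi>}" for \<rho>
  proof (rule less.hyps)
    have "\<pi> \<notin> ?D \<rho>" using refines_asym \<rho> by blast
    moreover have "?D \<rho> \<subseteq> ?D \<pi>" using refines_trans \<rho> by blast
    ultimately have "?D \<rho> \<subset> ?D \<pi>" using mem by blast
    then show "card (?D \<rho>) < card (?D \<pi>)" by (rule psubset_card_mono[OF fin])
    show "\<rho> \<in> NCZ n" using \<rho> by simp
  qed
  then have "sum F (?D \<pi> - {\<pi>}) = sum G (?D \<pi> - {\<pi>})" by (rule sum.cong[OF refl])
  then show ?case
    using sums[OF less.prems] sum.remove[OF fin mem, of F] sum.remove[OF fin mem, of G] by simp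
qed

theorem proposition2p18:
  fixes scale :: "complex \<Rightarrow> 'a::ring_1 \<Rightarrow> 'a"
    and \<psi> D\<psi> :: "'a \<Rightarrow> complex"
    and a :: "nat \<Rightarrow> 'a"
    and p n :: nat
    and I :: "nat \<Rightarrow> nat set"
    and \<pi> :: "int set set"
  assumes "unital_complex_algebra scale"
    and "linear_functional scale \<psi>" and "\<psi> 1 = 1"
    and "linear_functional scale D\<psi>" and "tracial D\<psi>" and "D\<psi> 1 = 0"
    and "p \<ge> 1" and "n \<ge> 2"
    and "ordered_interval_partition p n I"
    and "\<pi> \<in> NCZ n"
  shows "bracketB n (free_cumulant \<psi>) (cyclic_free_cumulant \<psi> D\<psi>) \<pi>
           (\<lambda>k. prod_list (subword a (I k))) =
         (\<Sum>\<sigma> | \<sigma> \<in> NCZ p \<and> \<sigma> \<squnion>\<^bsub>NCB_order p\<^esub> barI n I = hat_partition p n I \<pi>.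
            bracketB p (free_cumulant \<psi>) (cyclic_free_cumulant \<psi> D\<psi>) \<sigma> a)"
proof -
  interpret interval_blocks p n I by unfold_locales fact
  let ?F = "\<lambda>\<rho>. bracketB n (free_cumulant \<psi>) (cyclic_free_cumulant \<psi> D\<psi>) \<rho> (\<lambda>k. prod_list (subword a (I k)))"
  let ?G = "\<lambda>\<rho>. \<Sum>\<sigma> | \<sigma> \<in> NCZ p \<and> \<sigma> \<squnion>\<^bsub>NCB_order p\<^esub> barI n I = spre ` \<rho>.
    bracketB p (free_cumulant \<psi>) (cyclic_free_cumulant \<psi> D\<psi>) \<sigma> a"
  have "?F \<pi> = ?G \<pi>"
  proof (rule eq_if_sums_over_refinements_eq[where F = ?F and G = ?G])
    \<comment> \<open>This \<open>\<pi>\<close> shadows the given one: the inversion needs equal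
      sums at every element of \<open>NCZ n\<close>.\<close>
    fix \<pi> assume \<pi>: "\<pi> \<in> NCZ n"
    let ?\<psi> = "\<lambda>xs. \<psi> (prod_list xs)" and ?D\<psi> = "\<lambda>xs. D\<psi> (prod_list xs)"
    have "(\<Sum>\<rho> | \<rho> \<in> NCZ n \<and> refines (signed_points n) \<rho> \<pi>. ?F \<rho>) =
        bracketB n ?\<psi> ?D\<psi> \<pi> (\<lambda>k. prod_list (subword a (I k)))"
      by (rule bracketB_moment_expansion[OF \<pi>, symmetric])
    also have "\<dots> = bracketB p ?\<psi> ?D\<psi> (spre ` \<pi>) a"
      by (rule bracketB_spre[OF \<pi>, symmetric])
    also have "\<dots> = (\<Sum>\<sigma> | \<sigma> \<in> NCZ p \<and> refines (signed_points p) \<sigma> (spre ` \<pi>).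
        bracketB p (free_cumulant \<psi>) (cyclic_free_cumulant \<psi> D\<psi>) \<sigma> a)"
      by (rule bracketB_moment_expansion[OF spre_NCZ[OF \<pi>]])
    also have "\<dots> = (\<Sum>\<rho> | \<rho> \<in> NCZ n \<and> refines (signed_points n) \<rho> \<pi>. ?G \<rho>)"
      by (rule sum_over_joins[OF \<open>p \<ge> 1\<close> \<pi>])
    finally show "(\<Sum>\<rho> | \<rho> \<in> NCZ n \<and> refines (signed_points n) \<rho> \<pi>. ?F \<rho>) =
      (\<Sum>\<rho> | \<rho> \<in> NCZ n \<and> refines (signed_points n) \<rho> \<pi>. ?G \<rho>)" .
  qed fact
  then show ?thesis using hat_partition_eq[of \<pi>] \<open>\<pi> \<in> NCZ n\<close> by (simp add: NCZ_def)
qed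

end
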